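(* Fix $\sigma>0$ and $\mathcal{E}>0$. Let $\mathsf{C}(\mathcal{E})=\sup I(X;Y)$, where $Y=X+Z$ with $Z\sim\mathcal{N}(0,\sigma^2)$ independent of $X$, and the supremum is over all distributions of $X$ with $X\ge0$ a.s. and $\mathbb{E}[X]\le\mathcal{E}$ (no peak constraint). Then $$\mathsf{C}(\mathcal{E})\ge\frac12\log\left(1+\frac{\mathcal{E}^2e}{2\pi\sigma^2}\right).$$ Moreover, for every $\beta>0$ and every $\delta\le-\sigma e^{-1/2}$, $$\begin{aligned}\mathsf{C}(\mathcal{E})\le{}&\log\left(\beta e^{-\frac{\delta^2}{2\sigma^2}}+\sqrt{2\pi}\sigma\,\mathcal{Q}\!\left(\tfrac{\delta}{\sigma}\right)\right)-\log\left(\sqrt{2\pi}\sigma\right)-\frac{\delta\mathcal{E}}{2\sigma^2}\\&+\frac{\delta^2}{2\sigma^2}\left(1-\mathcal{Q}\!\left(\tfrac{\delta}{\sigma}\right)-\frac{\mathcal{E}}{\delta}\mathcal{Q}\!\left(\tfrac{\delta}{\sigma}\right)\right)+\frac1\beta\left(\mathcal{E}+\frac{\sigma}{\sqrt{2\pi}}\right),\end{aligned}$$ and for every $\beta>0$ and every $\delta\ge0$, $$\begin{aligned}\mathsf{C}(\mathcal{E})\le{}&\log\left(\beta e^{-\frac{\delta^2}{2\sigma^2}}+\sqrt{2\pi}\sigma\,\mathcal{Q}\!\left(\tfrac{\delta}{\sigma}\right)\right)+\frac12\mathcal{Q}\!\left(\tfrac{\delta}{\sigma}\right)+\frac{\delta}{2\sqrt{2\pi}\sigma}e^{-\frac{\delta^2}{2\sigma^2}}\\&+\frac{\delta^2}{2\sigma^2}\left(1-\mathcal{Q}\!\left(\tfrac{\delta+\mathcal{E}}{\sigma}\right)\right)+\frac1\beta\left(\delta+\mathcal{E}+\frac{\sigma}{\sqrt{2\pi}}e^{-\frac{\delta^2}{2\sigma^2}}\right)-\frac12\log\left(2\pi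 e\sigma^2\right).\end{aligned}$$
   Context: $\mathcal{Q}(\xi)=\int_\xi^\infty\frac{1}{\sqrt{2\pi}}e^{-t^2/2}\,dt$ is the Gaussian Q-function. Logarithms are natural (capacity in nats). The channel is the free-space optical intensity channel with nonnegative input, average-power constraint $\mathcal{E}$ only, and additive Gaussian noise of variance $\sigma^2$. *)

theory Defs
  imports "HOL-Probability.Probability"
begin

definition Qfun :: "real \<Rightarrow> real" where
  "Qfun \<xi> = (\<integral>t\<in>{\<xi>..}. std_normal_density t \<partial>lborel)"

definition admissible_input :: "real \<Rightarrow> real measure \<Rightarrow> bool" where
  "admissible_input E P \<longleftrightarrow>
     prob_space P \<and> sets P = sets borel \<and> (AE x in P. 0 \<le> x) \<and>
     (\<integral>\<^sup>+ x. ennreal x \<partial>P) \<le> ennreal E"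

definition channel_space :: "real \<Rightarrow> real measure \<Rightarrow> (real \<times> real) measure" where
  "channel_space \<sigma> P = P \<Otimes>\<^sub>M density lborel (normal_density 0 \<sigma>)"

definition channel_MI :: "real \<Rightarrow> real measure \<Rightarrow> real" where
  "channel_MI \<sigma> P = prob_space.mutual_information (channel_space \<sigma> P) (exp 1)
       borel borel fst (\<lambda>(x, z). x + z)"

definition capacity :: "real \<Rightarrow> real \<Rightarrow> real" where
  "capacity \<sigma> E = Sup (channel_MI \<sigma> ` {P. admissible_input E P})"

end

theory Submission
  imports Defs
begin

text \<open>Upper bounds: for any density \<open>r\<close>, Gibbs' inequality bounds the mutual information by the
  cross entropy of the output relative to \<open>r\<close> minus the noise entropy. With \<open>r\<close> Gaussian left of \<open>- \<delta>\<close> and exponential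
  beyond, the cross entropy is estimated pointwise in the input and the noise; for \<open>\<delta> \<ge> 0\<close> one also uses
  Jensen's inequality for \<open>1 - Qfun\<close>, which is concave on the nonnegative reals.

  Lower bound: the input is exponential with mean \<open>E\<close>. Put \<open>s = \<sigma> / E\<close> and let \<open>N\<close> be standard normal.
  Integration by parts turns the mutual information into
  \<open>L s - s\<^sup>2 / 2 - ln s - ln (2 * pi * exp 1) / 2\<close>, where \<open>L s\<close> is the expectation of \<open>- ln (Qfun (N + s))\<close>.
  This replaces the entropy power inequality by a bound on one scalar function,
  \<open>F s \<ge> ln (s\<^sup>2 + exp 1 / (2 * pi)) / 2\<close> with \<open>F s = L s - s\<^sup>2 / 2 - 1/2 - ln (2 * pi) / 2\<close>.
  For \<open>s \<ge> 1/2\<close> it follows from Jensen's inequality after an exponential tilt. At \<open>s = 0\<close> it holds with equality, because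
  \<open>Qfun N\<close> is uniform; on \<open>[0, 1/2]\<close> it follows since \<open>F\<close> is concave (the Mills ratio is log-convex) and
  the right-hand side is convex.\<close>

subsection \<open>The Gaussian Q-function\<close>

lemma Qfun_nonneg: "0 \<le> Qfun x"
  by (auto simp: Qfun_def set_lebesgue_integral_def intro!: integral_nonneg_AE)

lemma set_integrable_std_normal_density:
  "B \<in> sets borel \<Longrightarrow> set_integrable lborel B std_normal_density"
  unfolding set_integrable_def real_scaleR_def
  by (rule integrable_real_mult_indicator[unfolded mult.commute[of _ "indicator _ _"]]) auto

lemma nn_integral_std_normal_atLeast:
  "(\<integral>\<^sup>+t. ennreal (std_normal_density t) * indicator {x..} t \<partial>lborel) = ennreal (Qfun x)"
proof -
  have "(\<integral>\<^sup>+t. ennreal (std_normal_density t) * indicator {x..} t \<partial>lborel)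
      = (\<integral>\<^sup>+t. ennreal (indicator {x..} t *\<^sub>R std_normal_density t) \<partial>lborel)"
    by (intro nn_integral_cong) (auto split: split_indicator)
  also have "\<dots> = ennreal (Qfun x)"
    unfolding Qfun_def set_lebesgue_integral_def
    by (intro nn_integral_eq_integral set_integrable_std_normal_density[unfolded set_integrable_def]) auto
  finally show ?thesis .
qed

lemma Qfun_minus: "Qfun (- x) = 1 - Qfun x"
proof -
  have "Qfun (-x) = (\<integral>t. indicator {..x} t *\<^sub>R std_normal_density t \<partial>lborel)"
    unfolding Qfun_def set_lebesgue_integral_def
    by (subst lborel_integral_real_affine[where c="-1" and t=0])
       (auto intro!: Bochner_Integration.integral_cong simp: std_normal_density_def split: split_indicator)
  moreover have "(\<integral>t. indicator {..x} t *\<^sub>R std_normal_density t \<partial>lborel) + Qfun x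
     = (\<integral>t. indicator {..x} t *\<^sub>R std_normal_density t + indicator {x..} t *\<^sub>R std_normal_density t \<partial>lborel)"
    unfolding Qfun_def set_lebesgue_integral_def
    by (subst Bochner_Integration.integral_add)
       (auto intro!: set_integrable_std_normal_density[unfolded set_integrable_def real_scaleR_def])
  moreover have "\<dots> = (\<integral>t. std_normal_density t \<partial>lborel)"
    by (intro integral_cong_AE) (use AE_lborel_singleton[of x] in \<open>auto split: split_indicator\<close>)
  ultimately show ?thesis by simp
qed

lemma Qfun_le_1: "Qfun x \<le> 1"
  using Qfun_minus[of x] Qfun_nonneg[of "-x"] by linarith

lemma DERIV_Qfun: "DERIV Qfun x :> - std_normal_density x"
proof -
  \<comment> \<open>Splitting off a compact interval that starts at \<open>x - 1\<close> leaves
    \<open>x\<close> in the interior, so the fundamental theorem for proper integrals yields a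
    two-sided derivative at \<open>x\<close>.\<close>
  have split: "Qfun y = Qfun (x - 1) - integral {x - 1..y} std_normal_density" if "x - 1 \<le> y" for y
  proof -
    have "(\<integral>t. indicator {x - 1..y} t *\<^sub>R std_normal_density t \<partial>lborel) + Qfun y
      = (\<integral>t. indicator {x - 1..y} t *\<^sub>R std_normal_density t + indicator {y..} t *\<^sub>R std_normal_density t \<partial>lborel)"
      unfolding Qfun_def set_lebesgue_integral_def
      by (subst Bochner_Integration.integral_add)
         (auto intro!: set_integrable_std_normal_density[unfolded set_integrable_def real_scaleR_def])
    also have "\<dots> = Qfun (x - 1)"
      unfolding Qfun_def set_lebesgue_integral_def using that
      by (intro integral_cong_AE) (use AE_lborel_singleton[of y] in \<open>auto split: split_indicator\<close>)
    finally show ?thesis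
      using set_borel_integral_eq_integral(2)[OF set_integrable_std_normal_density[of "{x - 1..y}"]]
      by (simp add: set_lebesgue_integral_def)
  qed
  have cont: "continuous_on S std_normal_density" for S
    unfolding std_normal_density_def by (intro continuous_intros) auto
  have "((\<lambda>y. Qfun (x - 1) - integral {x - 1..y} std_normal_density) has_real_derivative 0 - std_normal_density x)
     (at x within {x - 1..x + 1})"
    by (intro DERIV_diff integral_has_real_derivative[OF cont] DERIV_const) auto
  then have "((\<lambda>y. Qfun (x - 1) - integral {x - 1..y} std_normal_density) has_real_derivative - std_normal_density x) (at x)"
    by (subst (asm) at_within_interior) auto
  then show ?thesis
    by (rule DERIV_cong_ev[THEN iffD1, rotated -1])
       (auto simp: eventually_nhds_metric dist_real_def intro!: exI[of _ 1] split[symmetric])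
qed

lemmas DERIV_Qfun' [derivative_intros] = DERIV_Qfun[THEN DERIV_chain2]

lemma isCont_Qfun: "isCont Qfun x"
  using DERIV_Qfun DERIV_isCont by blast

lemma borel_measurable_Qfun [measurable]: "Qfun \<in> borel_measurable borel"
  by (intro borel_measurable_continuous_onI continuous_at_imp_continuous_on ballI isCont_Qfun)

lemma Qfun_strict_antimono: "x < y \<Longrightarrow> Qfun y < Qfun x"
  by (rule DERIV_neg_imp_decreasing[of x y Qfun])
     (auto intro!: exI[of _ "- std_normal_density _"] DERIV_Qfun normal_density_pos)

lemma Qfun_pos: "0 < Qfun x"
  using Qfun_strict_antimono[of x "x + 1"] Qfun_nonneg[of "x + 1"] by simp

lemma ln_Qfun_nonpos: "ln (Qfun x) \<le> 0"
  using Qfun_pos Qfun_le_1 by simp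

lemma tendsto_Qfun_at_top: "(Qfun \<longlongrightarrow> 0) at_top"
proof (rule tendsto_sandwich[of "\<lambda>_. 0" Qfun at_top "\<lambda>x. 1 / x\<^sup>2"])
  \<comment> \<open>Chebyshev: on \<open>{x..}\<close> one has
    \<open>1 \<le> t\<^sup>2 / x\<^sup>2\<close>, and the second moment is 1.\<close>
  have "Qfun x \<le> 1 / x\<^sup>2" if x: "x > 0" for x :: real
  proof -
    have "Qfun x \<le> (\<integral>t. (1 / x\<^sup>2) * (std_normal_density t * t^(2*1)) \<partial>lborel)"
      unfolding Qfun_def set_lebesgue_integral_def
    proof (rule integral_mono)
      show "integrable lborel (\<lambda>t. (1 / x\<^sup>2) * (std_normal_density t * t^(2*1)))"
        using integrable_std_normal_moment[of 2] by simp
      show "indicator {x..} t *\<^sub>R std_normal_density t \<le> (1 / x\<^sup>2) * (std_normal_density t * t^(2*1))" for t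
      proof (cases "x \<le> t")
        case True
        then have "x\<^sup>2 \<le> t\<^sup>2" using x by (intro power_mono) auto
        then have "std_normal_density t * x\<^sup>2 \<le> std_normal_density t * t\<^sup>2"
          by (intro mult_left_mono) auto
        then show ?thesis using True x by (simp add: field_simps power2_eq_square)
      qed simp
    qed (auto intro!: set_integrable_std_normal_density[unfolded set_integrable_def real_scaleR_def])
    also have "\<dots> = 1 / x\<^sup>2"
      using integral_std_normal_moment_even[of 1] by simp
    finally show ?thesis .
  qed
  then show "\<forall>\<^sub>F x in at_top. Qfun x \<le> 1 / x\<^sup>2"
    using eventually_gt_at_top[of 0] by (rule eventually_mono[rotated])
  show "((\<lambda>x::real. 1 / x\<^sup>2) \<longlongrightarrow> 0) at_top" by real_asymp
qed (auto simp: Qfun_nonneg)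

lemma tendsto_Qfun_at_bot: "(Qfun \<longlongrightarrow> 1) at_bot"
  unfolding filterlim_at_bot_mirror Qfun_minus
  by (auto intro!: tendsto_eq_intros tendsto_Qfun_at_top)

section \<open>Tail moments of the Gaussian density\<close>

lemma nn_integral_normal_atLeast:
  assumes "0 < \<sigma>"
  shows "(\<integral>\<^sup>+t. ennreal (normal_density m \<sigma> t) * indicator {a..} t \<partial>lborel) = ennreal (Qfun ((a - m) / \<sigma>))"
proof -
  have "(\<integral>\<^sup>+t. ennreal (normal_density m \<sigma> t) * indicator {a..} t \<partial>lborel) =
    \<bar>\<sigma>\<bar> * (\<integral>\<^sup>+t. ennreal (normal_density m \<sigma> (m + \<sigma> * t)) * indicator {a..} (m + \<sigma> * t) \<partial>lborel)"
    using assms by (intro nn_integral_real_affine) auto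
  also have "\<dots> = (\<integral>\<^sup>+t. ennreal (std_normal_density t) * indicator {(a - m) / \<sigma>..} t \<partial>lborel)"
    using assms
    by (subst nn_integral_cmult[symmetric])
       (auto intro!: nn_integral_cong split: split_indicator
         simp: normal_density_def field_simps power_mult_distrib real_sqrt_mult ennreal_mult'[symmetric])
  finally show ?thesis by (simp add: nn_integral_std_normal_atLeast)
qed

lemma DERIV_normal_density:
  "0 < \<sigma> \<Longrightarrow> DERIV (normal_density 0 \<sigma>) z :> - z / \<sigma>\<^sup>2 * normal_density 0 \<sigma> z"
  unfolding normal_density_def[abs_def]
  by (auto intro!: derivative_eq_intros simp: field_simps power2_eq_square)

text \<open>The common shape of the pointwise majorants in the upper bounds; the one for negative
  \<open>\<delta>\<close> has a further summand, which is peeled off first.\<close>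

lemma nn_integral_linear_comb4:
  assumes [measurable]: "f \<in> borel_measurable M" "g \<in> borel_measurable M" "h \<in> borel_measurable M" "k \<in> borel_measurable M"
  shows "(\<integral>\<^sup>+w. a * f w + (b * g w + c * (h w + k w)) \<partial>M) =
    a * (\<integral>\<^sup>+w. f w \<partial>M) + (b * (\<integral>\<^sup>+w. g w \<partial>M) + c * ((\<integral>\<^sup>+w. h w \<partial>M) + (\<integral>\<^sup>+w. k w \<partial>M)))"
  by (simp add: nn_integral_add nn_integral_cmult)

lemma nn_integral_lborel_reflect:
  fixes f :: "real \<Rightarrow> ennreal"
  assumes "f \<in> borel_measurable borel"
  shows "(\<integral>\<^sup>+z. f z \<partial>lborel) = (\<integral>\<^sup>+z. f (- z) \<partial>lborel)"
  using nn_integral_real_affine[of f "-1" 0] assms by simp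

lemma normal_density_scale:
  "0 < \<sigma> \<Longrightarrow> std_normal_density (z / \<sigma>) = \<sigma> * normal_density 0 \<sigma> z"
  by (simp add: normal_density_def real_sqrt_mult power_divide)

lemma square_normal_density:
  "0 < \<sigma> \<Longrightarrow> \<sigma>\<^sup>2 * normal_density 0 \<sigma> z = \<sigma> / sqrt (2 * pi) * exp (- (z\<^sup>2) / (2 * \<sigma>\<^sup>2))"
  by (simp add: normal_density_def real_sqrt_mult power2_eq_square)

text \<open>The density has derivative \<open>- z / \<sigma>\<^sup>2\<close> times itself, so it is
  an antiderivative for the first-moment part up to a factor; the constant part contributes
  \<open>Qfun\<close>.\<close>

lemma nn_integral_normal_linear_tail:
  assumes "0 < \<sigma>"
  shows "(\<integral>\<^sup>+z. ennreal (normal_density 0 \<sigma> z * (z - a)) * indicator {a..} z \<partial>lborel)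
    = ennreal (\<sigma>\<^sup>2 * normal_density 0 \<sigma> a - a * Qfun (a / \<sigma>))"
proof -
  have "((\<lambda>z. - (\<sigma>\<^sup>2 * normal_density 0 \<sigma> z) + a * Qfun (z / \<sigma>)) \<longlongrightarrow> - (\<sigma>\<^sup>2 * 0) + a * 0) at_top"
  proof (intro tendsto_intros)
    show "(normal_density 0 \<sigma> \<longlongrightarrow> 0) at_top"
      using assms unfolding normal_density_def[abs_def] by real_asymp
    show "((\<lambda>z. Qfun (z / \<sigma>)) \<longlongrightarrow> 0) at_top"
      using assms by (intro filterlim_compose[OF tendsto_Qfun_at_top]) real_asymp
  qed
  moreover have "DERIV (\<lambda>z. - (\<sigma>\<^sup>2 * normal_density 0 \<sigma> z) + a * Qfun (z / \<sigma>)) z :> normal_density 0 \<sigma> z * (z - a)" for z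
    using assms
    by (auto intro!: derivative_eq_intros DERIV_normal_density[THEN DERIV_chain2]
        simp: normal_density_scale field_simps power2_eq_square)
  ultimately show ?thesis
    by (subst nn_integral_FTC_atLeast[where F="\<lambda>z. - (\<sigma>\<^sup>2 * normal_density 0 \<sigma> z) + a * Qfun (z / \<sigma>)" and T="- (\<sigma>\<^sup>2 * 0) + a * 0"]) auto
qed

text \<open>The antiderivative comes from integrating \<open>z\<close> times
  \<open>z * normal_density 0 \<sigma> z\<close> by parts.\<close>

lemma nn_integral_normal_square_tail:
  assumes "0 < \<sigma>"
  shows "(\<integral>\<^sup>+z. ennreal (normal_density 0 \<sigma> z * z\<^sup>2) * indicator {a..} z \<partial>lborel)
    = ennreal (\<sigma>\<^sup>2 * Qfun (a / \<sigma>) + a * (\<sigma>\<^sup>2 * normal_density 0 \<sigma> a))"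
proof -
  let ?F = "\<lambda>z. - (\<sigma>\<^sup>2 * Qfun (z / \<sigma>) + \<sigma>\<^sup>2 * (z * normal_density 0 \<sigma> z))"
  have "(?F \<longlongrightarrow> - (\<sigma>\<^sup>2 * 0 + \<sigma>\<^sup>2 * 0)) at_top"
  proof (intro tendsto_intros)
    show "((\<lambda>z. z * normal_density 0 \<sigma> z) \<longlongrightarrow> 0) at_top"
      using assms unfolding normal_density_def[abs_def] by real_asymp
    show "((\<lambda>z. Qfun (z / \<sigma>)) \<longlongrightarrow> 0) at_top"
      using assms by (intro filterlim_compose[OF tendsto_Qfun_at_top]) real_asymp
  qed
  moreover have "DERIV ?F z :> normal_density 0 \<sigma> z * z\<^sup>2" for z
    using assms
    by (auto intro!: derivative_eq_intros DERIV_normal_density[THEN DERIV_chain2]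
        simp: normal_density_scale field_simps power2_eq_square)
  ultimately show ?thesis
    by (subst nn_integral_FTC_atLeast[where F="?F" and T="- (\<sigma>\<^sup>2 * 0 + \<sigma>\<^sup>2 * 0)"]) (auto simp: ac_simps)
qed

text \<open>Concavity of \<open>1 - Qfun\<close> on the nonnegative reals, in tangent form: its
  slope, the Gaussian density, decreases there, and the mean value theorem compares chord and
  tangent. Integrating a tangent later takes the place of Jensen's inequality.\<close>

lemma Qfun_minus_tangent:
  assumes "0 \<le> a" "0 \<le> b"
  shows "Qfun (- b) \<le> Qfun (- a) + (b - a) * std_normal_density a"
proof -
  have anti: "std_normal_density y \<le> std_normal_density x" if "0 \<le> x" "x \<le> y" for x y
    using that by (auto simp: std_normal_density_def intro!: divide_right_mono power_mono)
  have der: "DERIV (\<lambda>t. Qfun (- t)) t :> std_normal_density t" for t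
    by (auto intro!: derivative_eq_intros simp: std_normal_density_def)
  consider "a = b" | "a < b" | "b < a" by linarith
  then show ?thesis
  proof cases
    case 2
    then obtain c where c: "a < c" "c < b" "Qfun (- b) - Qfun (- a) = (b - a) * std_normal_density c"
      using MVT2[of a b "\<lambda>t. Qfun (- t)", OF _ der] by blast
    then have "(b - a) * std_normal_density c \<le> (b - a) * std_normal_density a"
      using anti[of a c] assms 2 by (intro mult_left_mono) auto
    then show ?thesis using c by linarith
  next
    case 3
    then obtain c where c: "b < c" "c < a" "Qfun (- a) - Qfun (- b) = (a - b) * std_normal_density c"
      using MVT2[of b a "\<lambda>t. Qfun (- t)", OF _ der] by blast
    then have "(a - b) * std_normal_density a \<le> (a - b) * std_normal_density c"
      using anti[of c a] assms 3 by (intro mult_left_mono) auto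
    then show ?thesis using c by (simp add: algebra_simps)
  qed simp
qed

subsection \<open>Mutual information of the additive Gaussian channel\<close>

lemma measurable_normal_density2 [measurable (raw)]:
  assumes [measurable]: "f \<in> borel_measurable M" "g \<in> borel_measurable M"
  shows "(\<lambda>w. normal_density (f w) \<sigma> (g w)) \<in> borel_measurable M"
  unfolding normal_density_def by measurable

locale gaussian_channel = prob_space P for P :: "real measure" +
  fixes \<sigma> :: real
  assumes sets_P [measurable_cong]: "sets P = sets borel"
    and \<sigma>_pos: "0 < \<sigma>"
begin

abbreviation noise :: "real measure" where
  "noise \<equiv> density lborel (normal_density 0 \<sigma>)"

abbreviation CS :: "(real \<times> real) measure" where
  "CS \<equiv> channel_space \<sigma> P"

definition out_density :: "real \<Rightarrow> real" where
  "out_density y = (\<integral>x. normal_density x \<sigma> y \<partial>P)"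

sublocale noise: prob_space noise
  by (rule prob_space_normal_density[OF \<sigma>_pos])

lemma space_P [simp]: "space P = UNIV"
  using sets_eq_imp_space_eq[OF sets_P] by simp

lemma emeasure_P_UNIV [simp]: "emeasure P UNIV = 1"
  using emeasure_space_1 by simp

lemma prob_P_UNIV [simp]: "prob UNIV = 1"
  using prob_space by simp

sublocale PN: pair_prob_space P noise ..

sublocale PL: pair_sigma_finite P lborel ..

sublocale CS: prob_space CS
  unfolding channel_space_def by (rule PN.prob_space_axioms)

lemma sets_CS [measurable_cong]: "sets CS = sets (borel \<Otimes>\<^sub>M borel)"
  unfolding channel_space_def by (intro sets_pair_measure_cong sets_P) simp

lemma space_CS [simp]: "space CS = UNIV"
  using sets_eq_imp_space_eq[OF sets_CS] by (simp add: space_pair_measure)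

lemma normal_density_le: "normal_density x \<sigma> y \<le> 1 / sqrt (2 * pi * \<sigma>\<^sup>2)"
  using \<sigma>_pos by (auto simp: normal_density_def divide_simps)

lemma integrable_normal_density_P: "integrable P (\<lambda>x. normal_density x \<sigma> y)"
  using normal_density_le
  by (intro integrable_const_bound[of _ "1 / sqrt (2 * pi * \<sigma>\<^sup>2)"]) auto

lemma prob_CS_UNIV [simp]: "CS.prob UNIV = 1"
  using CS.prob_space by simp

lemma measurable_out_density [measurable]: "out_density \<in> borel_measurable borel"
  unfolding out_density_def by measurable

lemma out_density_pos: "0 < out_density y"
proof -
  have "(\<integral>x. 0 \<partial>P) < (\<integral>x. normal_density x \<sigma> y \<partial>P)"
    by (intro integral_less_AE_space integrable_normal_density_P)
       (auto simp: normal_density_pos[OF \<sigma>_pos] emeasure_space_1)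
  then show ?thesis by (simp add: out_density_def)
qed

lemma out_density_le: "out_density y \<le> 1 / sqrt (2 * pi * \<sigma>\<^sup>2)"
proof -
  have "(\<integral>x. normal_density x \<sigma> y \<partial>P) \<le> (\<integral>x. 1 / sqrt (2 * pi * \<sigma>\<^sup>2) \<partial>P)"
    by (intro integral_mono integrable_normal_density_P normal_density_le) auto
  then show ?thesis by (simp add: out_density_def)
qed

lemma nn_integral_out_density:
  "ennreal (out_density y) = (\<integral>\<^sup>+x. ennreal (normal_density x \<sigma> y) \<partial>P)"
  unfolding out_density_def
  by (intro nn_integral_eq_integral[symmetric] integrable_normal_density_P) auto

text \<open>The substitution \<open>z = y - x\<close> passes from noise to output.\<close>

lemma nn_integral_CS:
  assumes [measurable]: "g \<in> borel_measurable (borel \<Otimes>\<^sub>M borel)"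
  shows "(\<integral>\<^sup>+w. g w \<partial>CS) = (\<integral>\<^sup>+x. \<integral>\<^sup>+y. ennreal (normal_density x \<sigma> y) * g (x, y - x) \<partial>lborel \<partial>P)"
proof -
  have "(\<integral>\<^sup>+w. g w \<partial>CS) = (\<integral>\<^sup>+x. \<integral>\<^sup>+z. g (x, z) \<partial>noise \<partial>P)"
    unfolding channel_space_def by (rule noise.nn_integral_fst[symmetric]) measurable
  also have "\<dots> = (\<integral>\<^sup>+x. \<integral>\<^sup>+z. ennreal (normal_density 0 \<sigma> z) * g (x, z) \<partial>lborel \<partial>P)"
    by (intro nn_integral_cong nn_integral_density) measurable
  also have "\<dots> = (\<integral>\<^sup>+x. \<integral>\<^sup>+y. ennreal (normal_density x \<sigma> y) * g (x, y - x) \<partial>lborel \<partial>P)"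
  proof (rule nn_integral_cong)
    fix x :: real
    have "(\<integral>\<^sup>+z. ennreal (normal_density 0 \<sigma> z) * g (x, z) \<partial>lborel)
       = ennreal \<bar>1\<bar> * (\<integral>\<^sup>+y. ennreal (normal_density 0 \<sigma> (- x + 1 * y)) * g (x, - x + 1 * y) \<partial>lborel)"
      by (intro nn_integral_real_affine) auto
    also have "\<dots> = (\<integral>\<^sup>+y. ennreal (normal_density x \<sigma> y) * g (x, y - x) \<partial>lborel)"
      by (simp add: normal_density_def)
    finally show "(\<integral>\<^sup>+z. ennreal (normal_density 0 \<sigma> z) * g (x, z) \<partial>lborel) = \<dots>" .
  qed
  finally show ?thesis .
qed

lemma nn_integral_output:
  assumes [measurable]: "h \<in> borel_measurable borel"
  shows "(\<integral>\<^sup>+w. h (fst w + snd w) \<partial>CS) = (\<integral>\<^sup>+y. ennreal (out_density y) * h y \<partial>lborel)"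
proof -
  have "(\<integral>\<^sup>+w. h (fst w + snd w) \<partial>CS)
      = (\<integral>\<^sup>+x. \<integral>\<^sup>+y. ennreal (normal_density x \<sigma> y) * h y \<partial>lborel \<partial>P)"
    by (subst nn_integral_CS) auto
  also have "\<dots> = (\<integral>\<^sup>+y. \<integral>\<^sup>+x. ennreal (normal_density x \<sigma> y) * h y \<partial>P \<partial>lborel)"
    by (rule PL.Fubini'[symmetric]) measurable
  also have "\<dots> = (\<integral>\<^sup>+y. ennreal (out_density y) * h y \<partial>lborel)"
    by (simp add: nn_integral_out_density nn_integral_multc)
  finally show ?thesis .
qed

lemma distr_fst_CS: "distr CS P fst = P"
  unfolding channel_space_def by (rule noise.distr_pair_fst)

lemma distr_snd_CS: "distr CS noise snd = noise"
  unfolding channel_space_def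
proof (rule measure_eqI)
  fix A assume A: "A \<in> sets (distr (P \<Otimes>\<^sub>M noise) noise snd)"
  have "emeasure (distr (P \<Otimes>\<^sub>M noise) noise snd) A = emeasure (P \<Otimes>\<^sub>M noise) (UNIV \<times> A)"
    using A by (subst emeasure_distr) (auto simp: space_pair_measure intro!: arg_cong[where f="emeasure _"])
  also have "\<dots> = emeasure noise A"
    using A emeasure_space_1 by (subst noise.emeasure_pair_measure_Times) (auto simp: sets_P)
  finally show "emeasure (distr (P \<Otimes>\<^sub>M noise) noise snd) A = emeasure noise A" .
qed simp

text \<open>The input law may be discrete or singular, so the reference measure on the input side is
  \<open>P\<close> itself; relative to it the joint density is the transition density of the
  channel.\<close>

lemma distributed_joint:
  "distributed CS (P \<Otimes>\<^sub>M lborel) (\<lambda>w. (fst w, fst w + snd w)) (\<lambda>(x, y). normal_density x \<sigma> y)"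
  unfolding distributed_def
proof (intro conjI measure_eqI)
  fix A assume "A \<in> sets (distr CS (P \<Otimes>\<^sub>M lborel) (\<lambda>w. (fst w, fst w + snd w)))"
  then have [measurable]: "A \<in> sets (P \<Otimes>\<^sub>M lborel)" by simp
  then have [measurable]: "A \<in> sets (borel \<Otimes>\<^sub>M borel)"
    by (subst (asm) sets_pair_measure_cong[OF sets_P sets_lborel])
  have "emeasure (distr CS (P \<Otimes>\<^sub>M lborel) (\<lambda>w. (fst w, fst w + snd w))) A
     = (\<integral>\<^sup>+w. indicator A w \<partial>distr CS (P \<Otimes>\<^sub>M lborel) (\<lambda>w. (fst w, fst w + snd w)))"
    by (rule nn_integral_indicator[symmetric]) simp
  also have "\<dots> = (\<integral>\<^sup>+w. indicator A (fst w, fst w + snd w) \<partial>CS)"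
    by (intro nn_integral_distr) measurable
  also have "\<dots> = (\<integral>\<^sup>+x. \<integral>\<^sup>+y. ennreal (normal_density x \<sigma> y) * indicator A (x, y) \<partial>lborel \<partial>P)"
    by (subst nn_integral_CS) auto
  also have "\<dots> = (\<integral>\<^sup>+w. ennreal (case w of (x, y) \<Rightarrow> normal_density x \<sigma> y) * indicator A w \<partial>(P \<Otimes>\<^sub>M lborel))"
    by (subst lborel.nn_integral_fst[symmetric]) auto
  also have "\<dots> = emeasure (density (P \<Otimes>\<^sub>M lborel) (\<lambda>(x, y). normal_density x \<sigma> y)) A"
    by (subst emeasure_density) (auto simp: case_prod_unfold)
  finally show "emeasure (distr CS (P \<Otimes>\<^sub>M lborel) (\<lambda>w. (fst w, fst w + snd w))) A = \<dots>" .
qed (simp_all, measurable)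

lemma distributed_output: "distributed CS lborel (\<lambda>w. fst w + snd w) out_density"
  unfolding distributed_def
proof (intro conjI measure_eqI)
  fix A assume "A \<in> sets (distr CS lborel (\<lambda>w. fst w + snd w))"
  then have [measurable]: "A \<in> sets borel" by simp
  have "emeasure (distr CS lborel (\<lambda>w. fst w + snd w)) A
     = (\<integral>\<^sup>+w. indicator A w \<partial>distr CS lborel (\<lambda>w. fst w + snd w))"
    by (rule nn_integral_indicator[symmetric]) simp
  also have "\<dots> = (\<integral>\<^sup>+w. indicator A (fst w + snd w) \<partial>CS)"
    by (intro nn_integral_distr) measurable
  also have "\<dots> = emeasure (density lborel out_density) A"
    by (subst nn_integral_output) (auto simp: emeasure_density)
  finally show "emeasure (distr CS lborel (\<lambda>w. fst w + snd w)) A = \<dots>" .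
qed (simp_all, measurable)

lemma distributed_input: "distributed CS P fst (\<lambda>_. ennreal 1)"
  unfolding distributed_def using distr_fst_CS
  by (auto simp: density_1 channel_space_def)

lemma channel_MI_eq:
  "channel_MI \<sigma> P = (\<integral>w. ln (normal_density 0 \<sigma> (snd w) / out_density (fst w + snd w)) \<partial>CS)"
proof -
  interpret I: information_space CS "exp 1"
    by unfold_locales auto
  let ?Y = "\<lambda>w::real\<times>real. fst w + snd w"
  have "channel_MI \<sigma> P = prob_space.mutual_information CS (exp 1) borel borel fst ?Y"
    by (simp add: channel_MI_def case_prod_unfold)
  \<comment> \<open>\<open>mutual_information\<close> sees its two reference measures only through
    their sigma-algebras. Trading \<open>borel\<close> for \<open>P\<close> and
    \<open>lborel\<close> brings the density formula into play.\<close>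
  also have "\<dots> = prob_space.mutual_information CS (exp 1) P lborel fst ?Y"
    unfolding CS.mutual_information_def
    by (intro arg_cong2[where f="KL_divergence (exp 1)"] arg_cong2[where f="(\<Otimes>\<^sub>M)"] distr_cong
      sets_pair_measure_cong) (auto simp: sets_P)
  also have "\<dots> = (\<integral>v. (case v of (x, y) \<Rightarrow> normal_density x \<sigma> y) *
      log (exp 1) ((case v of (x, y) \<Rightarrow> normal_density x \<sigma> y) / (1 * out_density (snd v))) \<partial>(P \<Otimes>\<^sub>M lborel))"
    using distributed_joint
    by (intro I.mutual_information_distr[where Px="\<lambda>_. 1"] distributed_input distributed_output)
       (auto intro: sigma_finite_measure lborel.sigma_finite_measure_axioms sigma_finite_measure_axioms
          less_imp_le out_density_pos simp: case_prod_unfold)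
  also have "\<dots> = (\<integral>v. ln ((case v of (x, y) \<Rightarrow> normal_density x \<sigma> y) / out_density (snd v))
      \<partial>density (P \<Otimes>\<^sub>M lborel) (\<lambda>(x, y). normal_density x \<sigma> y))"
    by (subst integral_density) (auto simp: log_def case_prod_unfold)
  also have "\<dots> = (\<integral>v. ln ((case v of (x, y) \<Rightarrow> normal_density x \<sigma> y) / out_density (snd v))
      \<partial>distr CS (P \<Otimes>\<^sub>M lborel) (\<lambda>w. (fst w, fst w + snd w)))"
    using distributed_distr_eq_density[OF distributed_joint] by (simp add: case_prod_unfold)
  also have "\<dots> = (\<integral>w. ln (normal_density (fst w) \<sigma> (fst w + snd w) / out_density (fst w + snd w)) \<partial>CS)"
    by (subst integral_distr) auto
  also have "\<dots> = (\<integral>w. ln (normal_density 0 \<sigma> (snd w) / out_density (fst w + snd w)) \<partial>CS)"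
    by (simp add: normal_density_def)
  finally show ?thesis .
qed

lemma integrable_noise:
  assumes "integrable lborel (\<lambda>z. normal_density 0 \<sigma> z * h z)" and [measurable]: "h \<in> borel_measurable borel"
  shows "integrable CS (\<lambda>w. h (snd w))"
    and "(\<integral>w. h (snd w) \<partial>CS) = (\<integral>z. normal_density 0 \<sigma> z * h z \<partial>lborel)"
proof -
  have [measurable]: "snd \<in> measurable CS noise" by measurable
  have "integrable noise h"
    using assms by (subst integrable_density) auto
  then show "integrable CS (\<lambda>w. h (snd w))"
    using integrable_distr[of snd CS noise h] by (simp add: distr_snd_CS)
  have "(\<integral>w. h (snd w) \<partial>CS) = (\<integral>z. h z \<partial>distr CS noise snd)"
    by (rule integral_distr[symmetric]) auto
  then show "(\<integral>w. h (snd w) \<partial>CS) = (\<integral>z. normal_density 0 \<sigma> z * h z \<partial>lborel)"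
    by (simp add: distr_snd_CS integral_density)
qed

lemma ln_noise_density: "ln (normal_density 0 \<sigma> z) = - (1/2) * ln (2 * pi * \<sigma>\<^sup>2) - z\<^sup>2 / (2 * \<sigma>\<^sup>2)"
  using \<sigma>_pos by (simp add: normal_density_def ln_mult ln_div ln_sqrt)

lemma integrable_noise_square: "integrable CS (\<lambda>w. (snd w)\<^sup>2)"
  and integral_noise_square: "(\<integral>w. (snd w)\<^sup>2 \<partial>CS) = \<sigma>\<^sup>2"
  using integrable_noise[of "\<lambda>z. z\<^sup>2"] integrable_normal_moment[OF \<sigma>_pos, of 0 2]
    integral_normal_moment_even[OF \<sigma>_pos, of 0 1] by auto

lemma integrable_ln_noise_density: "integrable CS (\<lambda>w. ln (normal_density 0 \<sigma> (snd w)))"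
  and integral_ln_noise_density:
    "(\<integral>w. ln (normal_density 0 \<sigma> (snd w)) \<partial>CS) = - (1/2) * ln (2 * pi * exp 1 * \<sigma>\<^sup>2)"
  using integrable_noise_square integral_noise_square \<sigma>_pos
  by (auto simp: ln_noise_density ln_mult ln_sqrt field_simps)

text \<open>Output entropy minus noise entropy. Splitting the logarithm of the quotient under the
  integral requires both parts to be integrable.\<close>

lemma channel_MI_eq_entropy_diff:
  assumes "integrable CS (\<lambda>w. ln (out_density (fst w + snd w)))"
  shows "channel_MI \<sigma> P = - (\<integral>w. ln (out_density (fst w + snd w)) \<partial>CS) - 1/2 * ln (2 * pi * exp 1 * \<sigma>\<^sup>2)"
proof -
  have "channel_MI \<sigma> P = (\<integral>w. ln (normal_density 0 \<sigma> (snd w)) - ln (out_density (fst w + snd w)) \<partial>CS)"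
    unfolding channel_MI_eq
    by (intro Bochner_Integration.integral_cong refl ln_divide_pos normal_density_pos \<sigma>_pos out_density_pos)
  then show ?thesis
    using assms integrable_ln_noise_density by (simp add: integral_ln_noise_density)
qed

text \<open>Gibbs' inequality against the test density \<open>exp (- q y) / K\<close>, whose mass is
  at most 1. The same comparison shows that the output entropy is finite, which the entropy formula
  for \<open>channel_MI\<close> asks for.\<close>

lemma
  fixes q :: "real \<Rightarrow> real"
  assumes [measurable]: "q \<in> borel_measurable borel"
    and K: "0 < K" "(\<integral>\<^sup>+y. ennreal (exp (- q y)) \<partial>lborel) \<le> ennreal K"
    and q: "integrable CS (\<lambda>w. q (fst w + snd w))"
  shows integrable_ln_out_density: "integrable CS (\<lambda>w. ln (out_density (fst w + snd w)))"
    and channel_MI_le_dual: "channel_MI \<sigma> P \<le> ln K + (\<integral>w. q (fst w + snd w) \<partial>CS) - 1/2 * ln (2 * pi * exp 1 * \<sigma>\<^sup>2)"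
proof -
  \<comment> \<open>Ratio of the test density to the output density; its mean under the output law
    is the mass of the test density.\<close>
  define r where "r y = exp (- q y) / (K * out_density y)" for y
  have [measurable]: "r \<in> borel_measurable borel" unfolding r_def by measurable
  have r_pos: "0 < r y" for y using K out_density_pos by (simp add: r_def)
  have "(\<integral>\<^sup>+w. ennreal (r (fst w + snd w)) \<partial>CS) = (\<integral>\<^sup>+y. ennreal (out_density y) * ennreal (r y) \<partial>lborel)"
    by (rule nn_integral_output) auto
  also have "\<dots> = (\<integral>\<^sup>+y. ennreal (1 / K) * ennreal (exp (- q y)) \<partial>lborel)"
    using K out_density_pos by (intro nn_integral_cong)
      (auto simp: r_def ennreal_mult'[symmetric] less_imp_le less_imp_neq[symmetric] field_simps intro!: arg_cong[where f=ennreal])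
  also have "\<dots> = ennreal (1 / K) * (\<integral>\<^sup>+y. ennreal (exp (- q y)) \<partial>lborel)"
    by (rule nn_integral_cmult) auto
  also have "\<dots> \<le> ennreal (1 / K) * ennreal K"
    by (intro mult_left_mono K) auto
  also have "\<dots> = 1" using K by (simp add: ennreal_mult'[symmetric])
  finally have r1: "(\<integral>\<^sup>+w. ennreal (r (fst w + snd w)) \<partial>CS) \<le> 1" .
  have r_int: "integrable CS (\<lambda>w. r (fst w + snd w))"
    using r1 r_pos by (intro integrableI_nonneg) (auto simp: less_imp_le intro: le_less_trans)
  have "ennreal (\<integral>w. r (fst w + snd w) \<partial>CS) \<le> 1"
    using r1 r_pos by (subst nn_integral_eq_integral[OF r_int, symmetric]) (auto simp: less_imp_le)
  then have r_le: "(\<integral>w. r (fst w + snd w) \<partial>CS) \<le> 1"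
    by (simp add: ennreal_le_1)
  \<comment> \<open>This is \<open>ln t \<le> t - 1\<close> at \<open>t = r y\<close>. Integrated,
    it gives Gibbs' inequality; together with the constant bound \<open>upper\<close> it dominates
    the logarithm by an integrable function.\<close>
  have lower: "1 - r y - q y - ln K \<le> ln (out_density y)" for y
  proof -
    have "ln (r y) \<le> r y - 1" by (rule ln_le_minus_one[OF r_pos])
    moreover have "ln (r y) = - q y - ln K - ln (out_density y)"
      using K out_density_pos[of y] by (simp add: r_def ln_div ln_mult)
    ultimately show ?thesis by linarith
  qed
  have upper: "ln (out_density y) \<le> ln (1 / sqrt (2 * pi * \<sigma>\<^sup>2))" for y
    using out_density_pos[of y] out_density_le[of y] \<sigma>_pos by (subst ln_le_cancel_iff) auto
  let ?B = "\<lambda>w. \<bar>1 - r (fst w + snd w) - q (fst w + snd w) - ln K\<bar> + \<bar>ln (1 / sqrt (2 * pi * \<sigma>\<^sup>2))\<bar>"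
  show int: "integrable CS (\<lambda>w. ln (out_density (fst w + snd w)))"
  proof (rule Bochner_Integration.integrable_bound)
    show "integrable CS ?B" using r_int q by auto
    have "\<bar>ln (out_density (fst w + snd w))\<bar> \<le> ?B w" for w
      using upper[of "fst w + snd w"] lower[of "fst w + snd w"] by linarith
    then show "AE w in CS. norm (ln (out_density (fst w + snd w))) \<le> norm (?B w)"
      by (simp add: order_trans[OF _ abs_ge_self])
  qed measurable
  have "(\<integral>w. 1 - r (fst w + snd w) - q (fst w + snd w) - ln K \<partial>CS) \<le> (\<integral>w. ln (out_density (fst w + snd w)) \<partial>CS)"
    using r_int q int lower by (intro integral_mono) auto
  then have "1 - (\<integral>w. r (fst w + snd w) \<partial>CS) - (\<integral>w. q (fst w + snd w) \<partial>CS) - ln K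
      \<le> (\<integral>w. ln (out_density (fst w + snd w)) \<partial>CS)"
    using r_int q by (simp add:)
  then show "channel_MI \<sigma> P \<le> ln K + (\<integral>w. q (fst w + snd w) \<partial>CS) - 1/2 * ln (2 * pi * exp 1 * \<sigma>\<^sup>2)"
    unfolding channel_MI_eq_entropy_diff[OF int] using r_le by linarith
qed

end

subsection \<open>Duality bounds\<close>

context gaussian_channel
begin

text \<open>Independence of input and noise.\<close>

lemma nn_integral_CS_mult:
  assumes [measurable]: "g \<in> borel_measurable borel" "h \<in> borel_measurable borel"
  shows "(\<integral>\<^sup>+w. g (fst w) * h (snd w) \<partial>CS) =
    (\<integral>\<^sup>+x. g x \<partial>P) * (\<integral>\<^sup>+z. ennreal (normal_density 0 \<sigma> z) * h z \<partial>lborel)"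
proof -
  have "(\<integral>\<^sup>+w. g (fst w) * h (snd w) \<partial>CS) = (\<integral>\<^sup>+x. \<integral>\<^sup>+z. g x * h z \<partial>noise \<partial>P)"
    unfolding channel_space_def by (subst noise.nn_integral_fst[symmetric]) auto
  then show ?thesis
    by (simp add: nn_integral_cmult nn_integral_multc nn_integral_density)
qed

lemma nn_integral_input:
  "g \<in> borel_measurable borel \<Longrightarrow> (\<integral>\<^sup>+w. g (fst w) \<partial>CS) = (\<integral>\<^sup>+x. g x \<partial>P)"
  using nn_integral_CS_mult[of g "\<lambda>_. 1"] noise.emeasure_space_1
  by (simp add: emeasure_density)

lemma nn_integral_noise:
  "h \<in> borel_measurable borel \<Longrightarrow>
    (\<integral>\<^sup>+w. h (snd w) \<partial>CS) = (\<integral>\<^sup>+z. ennreal (normal_density 0 \<sigma> z) * h z \<partial>lborel)"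
  using nn_integral_CS_mult[of "\<lambda>_. 1" h] by simp

text \<open>For a nonnegative exponent, one bound on an extended nonnegative integral yields both
  integrability and the estimate of the mean.\<close>

lemma channel_MI_le_dual_nn:
  fixes q :: "real \<Rightarrow> real"
  assumes [measurable]: "q \<in> borel_measurable borel" and q: "\<And>y. 0 \<le> q y"
    and K: "0 < K" "(\<integral>\<^sup>+y. ennreal (exp (- q y)) \<partial>lborel) \<le> ennreal K"
    and v: "0 \<le> v" "(\<integral>\<^sup>+w. ennreal (q (fst w + snd w)) \<partial>CS) \<le> ennreal v"
  shows "integrable CS (\<lambda>w. ln (out_density (fst w + snd w)))"
    and "channel_MI \<sigma> P \<le> ln K + v - 1/2 * ln (2 * pi * exp 1 * \<sigma>\<^sup>2)"
proof -
  have int: "integrable CS (\<lambda>w. q (fst w + snd w))"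
    using q v by (intro integrableI_nonneg) (auto intro: le_less_trans)
  then have "ennreal (\<integral>w. q (fst w + snd w) \<partial>CS) \<le> ennreal v"
    using v q by (subst nn_integral_eq_integral[symmetric]) auto
  then have "(\<integral>w. q (fst w + snd w) \<partial>CS) \<le> v" using v by simp
  then show "channel_MI \<sigma> P \<le> ln K + v - 1/2 * ln (2 * pi * exp 1 * \<sigma>\<^sup>2)"
    using channel_MI_le_dual[OF _ K int] by simp
  show "integrable CS (\<lambda>w. ln (out_density (fst w + snd w)))"
    by (rule integrable_ln_out_density[OF _ K int]) simp
qed

end

section \<open>The test density with a Gaussian left part and an exponential tail\<close>

locale optical_channel = gaussian_channel +
  fixes E :: real
  assumes E_pos: "0 < E"
    and input_nonneg: "AE x in P. 0 \<le> x"
    and input_mean: "(\<integral>\<^sup>+x. ennreal x \<partial>P) \<le> ennreal E"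
begin

lemma integrable_input: "integrable P (\<lambda>x. x)"
  using input_nonneg input_mean by (intro integrableI_nonneg) (auto intro: le_less_trans)

lemma integral_input_le: "(\<integral>x. x \<partial>P) \<le> E"
proof -
  have "ennreal (\<integral>x. x \<partial>P) \<le> ennreal E"
    using input_mean by (subst nn_integral_eq_integral[symmetric]) (auto simp: integrable_input input_nonneg)
  then show ?thesis using E_pos by simp
qed

lemma AE_CS_input_nonneg: "AE w in CS. 0 \<le> fst w"
proof -
  have [measurable]: "fst \<in> measurable CS P" by measurable
  have "AE x in distr CS P fst. 0 \<le> x" unfolding distr_fst_CS by (rule input_nonneg)
  then show ?thesis by (subst (asm) AE_distr_iff) auto
qed

lemma nn_integral_CS_input_le: "(\<integral>\<^sup>+w. ennreal (fst w) \<partial>CS) \<le> ennreal E"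
  using input_mean by (simp add: nn_integral_input)

text \<open>Up to normalisation, \<open>exp \<circ> (- dual_exponent \<beta> \<delta>)\<close> is the output density used in the duality bound:
  a Gaussian left of \<open>- \<delta>\<close>, continued by an exponential of mean \<open>\<beta>\<close>.\<close>
definition dual_exponent :: "real \<Rightarrow> real \<Rightarrow> real \<Rightarrow> real" where
  "dual_exponent \<beta> \<delta> y = (if y < - \<delta> then y\<^sup>2 / (2 * \<sigma>\<^sup>2) else \<delta>\<^sup>2 / (2 * \<sigma>\<^sup>2) + (y + \<delta>) / \<beta>)"

lemma measurable_dual_exponent [measurable]: "dual_exponent \<beta> \<delta> \<in> borel_measurable borel"
  unfolding dual_exponent_def by measurable

lemma dual_exponent_nonneg: "0 < \<beta> \<Longrightarrow> 0 \<le> dual_exponent \<beta> \<delta> y"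
  by (auto simp: dual_exponent_def)

abbreviation dual_norm :: "real \<Rightarrow> real \<Rightarrow> real" where
  "dual_norm \<beta> \<delta> \<equiv> \<beta> * exp (-(\<delta>^2) / (2 * \<sigma>^2)) + sqrt (2 * pi) * \<sigma> * Qfun (\<delta> / \<sigma>)"

lemma dual_norm_pos: "0 < \<beta> \<Longrightarrow> 0 < dual_norm \<beta> \<delta>"
  using \<sigma>_pos by (intro add_pos_nonneg) (auto simp: Qfun_nonneg)

text \<open>The Gaussian part contributes the \<open>Qfun\<close> term by reflection; the
  exponential part contributes \<open>\<beta>\<close> times its height at the junction
  \<open>- \<delta>\<close>.\<close>

lemma nn_integral_dual_exponent:
  assumes "0 < \<beta>"
  shows "(\<integral>\<^sup>+y. ennreal (exp (- dual_exponent \<beta> \<delta> y)) \<partial>lborel) \<le> ennreal (dual_norm \<beta> \<delta>)"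
proof -
  let ?g = "\<lambda>y. exp (- (y + \<delta>) / \<beta>)"
  have "(\<integral>\<^sup>+y. ennreal (?g y) * indicator {-\<delta>..} y \<partial>lborel) = 0 - (- \<beta> * ?g (-\<delta>))"
    using assms
    by (intro nn_integral_FTC_atLeast) (auto intro!: derivative_eq_intros simp: field_simps, real_asymp)
  then have exp: "(\<integral>\<^sup>+y. ennreal (?g y) * indicator {-\<delta>..} y \<partial>lborel) = ennreal \<beta>" by simp
  have "(\<integral>\<^sup>+y. ennreal (normal_density 0 \<sigma> y) * indicator {..-\<delta>} y \<partial>lborel)
     = (\<integral>\<^sup>+y. ennreal (normal_density 0 \<sigma> y) * indicator {\<delta>..} y \<partial>lborel)"
    by (subst nn_integral_lborel_reflect)
       (auto simp: normal_density_def intro!: nn_integral_cong split: split_indicator)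
  also have "\<dots> = ennreal (Qfun (\<delta> / \<sigma>))"
    using nn_integral_normal_atLeast[OF \<sigma>_pos, of 0 \<delta>] by simp
  finally have gauss: "(\<integral>\<^sup>+y. ennreal (normal_density 0 \<sigma> y) * indicator {..-\<delta>} y \<partial>lborel) = ennreal (Qfun (\<delta> / \<sigma>))" .
  have "(\<integral>\<^sup>+y. ennreal (exp (- dual_exponent \<beta> \<delta> y)) \<partial>lborel)
    \<le> (\<integral>\<^sup>+y. ennreal (exp (-(\<delta>^2) / (2 * \<sigma>^2))) * (ennreal (?g y) * indicator {-\<delta>..} y) +
         ennreal (sqrt (2 * pi) * \<sigma>) * (ennreal (normal_density 0 \<sigma> y) * indicator {..-\<delta>} y) \<partial>lborel)"
  proof (rule nn_integral_mono)
    fix y :: real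
    consider "y < - \<delta>" | "y \<ge> - \<delta>" by linarith
    then show "ennreal (exp (- dual_exponent \<beta> \<delta> y))
      \<le> ennreal (exp (-(\<delta>^2) / (2 * \<sigma>^2))) * (ennreal (?g y) * indicator {-\<delta>..} y) +
         ennreal (sqrt (2 * pi) * \<sigma>) * (ennreal (normal_density 0 \<sigma> y) * indicator {..-\<delta>} y)"
    proof cases
      case 1
      then show ?thesis using \<sigma>_pos
        by (simp add: dual_exponent_def normal_density_def real_sqrt_mult ennreal_mult'[symmetric])
    next
      case 2
      then have "exp (- dual_exponent \<beta> \<delta> y) = exp (-(\<delta>^2) / (2 * \<sigma>^2)) * ?g y"
        by (simp add: dual_exponent_def exp_add[symmetric] add_divide_distrib minus_divide_left[symmetric] diff_divide_distrib)
      then show ?thesis using 2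
        by (simp add: ennreal_mult'[symmetric])
    qed
  qed
  also have "\<dots> = ennreal (exp (-(\<delta>^2) / (2 * \<sigma>^2))) * ennreal \<beta> + ennreal (sqrt (2 * pi) * \<sigma>) * ennreal (Qfun (\<delta> / \<sigma>))"
    by (subst nn_integral_add, measurable, (subst nn_integral_cmult, measurable)+, simp only: exp gauss)
  also have "\<dots> = ennreal (dual_norm \<beta> \<delta>)"
    using assms \<sigma>_pos
    by (simp add: ennreal_mult'[symmetric] ennreal_plus[symmetric] Qfun_nonneg mult_ac del: ennreal_plus)
  finally show ?thesis .
qed

lemma channel_MI_le_of_dual_exponent:
  assumes "0 < \<beta>" "0 \<le> v" "(\<integral>\<^sup>+w. ennreal (dual_exponent \<beta> \<delta> (fst w + snd w)) \<partial>CS) \<le> ennreal v"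
  shows "channel_MI \<sigma> P \<le> ln (dual_norm \<beta> \<delta>) + v - 1/2 * ln (2 * pi * exp 1 * \<sigma>\<^sup>2)"
    and "integrable CS (\<lambda>w. ln (out_density (fst w + snd w)))"
proof -
  note * = channel_MI_le_dual_nn[OF measurable_dual_exponent dual_exponent_nonneg[OF assms(1)]
    dual_norm_pos[OF assms(1)] nn_integral_dual_exponent[OF assms(1)] assms(2,3)]
  show "channel_MI \<sigma> P \<le> ln (dual_norm \<beta> \<delta>) + v - 1/2 * ln (2 * pi * exp 1 * \<sigma>\<^sup>2)" by (rule *(2))
  show "integrable CS (\<lambda>w. ln (out_density (fst w + snd w)))" by (rule *(1))
qed

section \<open>Half-line moments of noise, input and output\<close>

lemma nn_integral_noise_linear_tail:
  "(\<integral>\<^sup>+w. ennreal (snd w - a) * indicator {a..} (snd w) \<partial>CS)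
    = ennreal (\<sigma> / sqrt (2 * pi) * exp (- (a\<^sup>2) / (2 * \<sigma>\<^sup>2)) - a * Qfun (a / \<sigma>))"
proof -
  have "(\<integral>\<^sup>+w. ennreal (snd w - a) * indicator {a..} (snd w) \<partial>CS)
    = (\<integral>\<^sup>+z. ennreal (normal_density 0 \<sigma> z) * (ennreal (z - a) * indicator {a..} z) \<partial>lborel)"
    by (rule nn_integral_noise) measurable
  also have "\<dots> = (\<integral>\<^sup>+z. ennreal (normal_density 0 \<sigma> z * (z - a)) * indicator {a..} z \<partial>lborel)"
    by (intro nn_integral_cong) (auto simp: ennreal_mult'[symmetric] split: split_indicator)
  finally show ?thesis
    by (simp only: nn_integral_normal_linear_tail[OF \<sigma>_pos] square_normal_density[OF \<sigma>_pos])
qed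

lemma nn_integral_noise_square_tail:
  "(\<integral>\<^sup>+w. ennreal ((snd w)\<^sup>2) * indicator {..-a} (snd w) \<partial>CS)
    = ennreal (\<sigma>\<^sup>2 * Qfun (a / \<sigma>) + a * (\<sigma> / sqrt (2 * pi) * exp (- (a\<^sup>2) / (2 * \<sigma>\<^sup>2))))"
proof -
  have "(\<integral>\<^sup>+w. ennreal ((snd w)\<^sup>2) * indicator {..-a} (snd w) \<partial>CS)
    = (\<integral>\<^sup>+z. ennreal (normal_density 0 \<sigma> z) * (ennreal (z\<^sup>2) * indicator {..-a} z) \<partial>lborel)"
    by (rule nn_integral_noise) measurable
  also have "\<dots> = (\<integral>\<^sup>+z. ennreal (normal_density 0 \<sigma> z * z\<^sup>2) * indicator {a..} z \<partial>lborel)"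
    by (subst nn_integral_lborel_reflect)
       (auto simp: normal_density_def ennreal_mult'[symmetric] intro!: nn_integral_cong split: split_indicator)
  finally show ?thesis
    by (simp only: nn_integral_normal_square_tail[OF \<sigma>_pos] square_normal_density[OF \<sigma>_pos])
qed

lemma nn_integral_noise_square: "(\<integral>\<^sup>+w. ennreal ((snd w)\<^sup>2) \<partial>CS) = ennreal (\<sigma>\<^sup>2)"
  using integrable_noise_square integral_noise_square by (subst nn_integral_eq_integral) auto

lemma nn_integral_noise_atLeast:
  "(\<integral>\<^sup>+w. indicator {a..} (snd w) \<partial>CS) = ennreal (Qfun (a / \<sigma>))"
  using nn_integral_normal_atLeast[OF \<sigma>_pos, of 0 a] by (subst nn_integral_noise) auto

lemma nn_integral_input_noise_atMost:
  "(\<integral>\<^sup>+w. ennreal (fst w) * indicator {..a} (snd w) \<partial>CS) \<le> ennreal (E * Qfun (- a / \<sigma>))"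
proof -
  have "(\<integral>\<^sup>+w. ennreal (fst w) * indicator {..a} (snd w) \<partial>CS)
     = (\<integral>\<^sup>+x. ennreal x \<partial>P) * (\<integral>\<^sup>+z. ennreal (normal_density 0 \<sigma> z) * indicator {..a} z \<partial>lborel)"
    by (rule nn_integral_CS_mult) measurable
  also have "(\<integral>\<^sup>+z. ennreal (normal_density 0 \<sigma> z) * indicator {..a} z \<partial>lborel)
     = (\<integral>\<^sup>+z. ennreal (normal_density 0 \<sigma> z) * indicator {-a..} z \<partial>lborel)"
    by (subst nn_integral_lborel_reflect)
       (auto simp: normal_density_def intro!: nn_integral_cong split: split_indicator)
  also have "\<dots> = ennreal (Qfun (- a / \<sigma>))"
    using nn_integral_normal_atLeast[OF \<sigma>_pos, of 0 "-a"] by simp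
  also have "(\<integral>\<^sup>+x. ennreal x \<partial>P) * ennreal (Qfun (- a / \<sigma>)) \<le> ennreal E * ennreal (Qfun (- a / \<sigma>))"
    by (intro mult_right_mono input_mean) simp
  also have "\<dots> = ennreal (E * Qfun (- a / \<sigma>))"
    using E_pos by (simp add: ennreal_mult')
  finally show ?thesis .
qed

text \<open>Given the input \<open>x\<close>, the output exceeds \<open>- \<delta>\<close> with
  probability \<open>Qfun (- ((\<delta> + x) / \<sigma>))\<close>, which is concave in
  \<open>x \<ge> 0\<close>. The tangent is taken at \<open>x = E\<close>; its slope is nonnegative,
  so the mean constraint finishes the estimate.\<close>

lemma nn_integral_output_atLeast:
  assumes "0 \<le> \<delta>"
  shows "(\<integral>\<^sup>+w. indicator {-\<delta>..} (fst w + snd w) \<partial>CS) \<le> ennreal (1 - Qfun ((\<delta> + E) / \<sigma>))"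
proof -
  let ?b = "(\<delta> + E) / \<sigma>"
  have Q_int: "integrable P (\<lambda>x. Qfun (- ((\<delta> + x) / \<sigma>)))"
    by (rule integrable_const_bound[of _ 1]) (auto simp: Qfun_nonneg Qfun_le_1)
  have "(\<integral>\<^sup>+w. indicator {-\<delta>..} (fst w + snd w) \<partial>CS) = (\<integral>\<^sup>+x. ennreal (Qfun ((- \<delta> - x) / \<sigma>)) \<partial>P)"
    by (subst nn_integral_CS) (auto simp: nn_integral_normal_atLeast[OF \<sigma>_pos])
  also have "\<dots> = (\<integral>\<^sup>+x. ennreal (Qfun (- ((\<delta> + x) / \<sigma>))) \<partial>P)"
    by (simp add: minus_divide_left)
  also have "\<dots> = ennreal (\<integral>x. Qfun (- ((\<delta> + x) / \<sigma>)) \<partial>P)"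
    by (intro nn_integral_eq_integral Q_int) (auto simp: Qfun_nonneg)
  also have "(\<integral>x. Qfun (- ((\<delta> + x) / \<sigma>)) \<partial>P)
      \<le> (\<integral>x. Qfun (- ?b) + (x - E) * (std_normal_density ?b / \<sigma>) \<partial>P)"
  proof (rule integral_mono_AE[OF Q_int])
    show "AE x in P. Qfun (- ((\<delta> + x) / \<sigma>)) \<le> Qfun (- ?b) + (x - E) * (std_normal_density ?b / \<sigma>)"
      using input_nonneg
    proof eventually_elim
      case (elim x)
      then have "Qfun (- ((\<delta> + x) / \<sigma>)) \<le> Qfun (- ?b) + ((\<delta> + x) / \<sigma> - ?b) * std_normal_density ?b"
        using assms E_pos \<sigma>_pos by (intro Qfun_minus_tangent) auto
      also have "(\<delta> + x) / \<sigma> - ?b = (x - E) / \<sigma>" by (simp add: diff_divide_distrib[symmetric])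
      finally show ?case by simp
    qed
  qed (use integrable_input in auto)
  also have "\<dots> = Qfun (- ?b) + ((\<integral>x. x \<partial>P) - E) * (std_normal_density ?b / \<sigma>)"
    using integrable_input by simp
  also have "\<dots> \<le> Qfun (- ?b)"
    using integral_input_le \<sigma>_pos by (simp add: mult_nonpos_nonneg divide_nonpos_pos)
  finally show ?thesis by (simp add: Qfun_minus ennreal_leI)
qed

text \<open>For \<open>\<delta> \<ge> 0\<close> a nonnegative input moves the output towards 0
  wherever the Gaussian part applies, so the quadratic term is controlled by the noise alone. The
  constant term costs the probability of an output above \<open>- \<delta>\<close>, the linear term
  a truncated noise mean. Integrability is exported for the exponential input.\<close>

lemma channel_MI_le_nonneg:
  assumes "0 < \<beta>" "0 \<le> \<delta>"
  shows "channel_MI \<sigma> P \<le> ln (dual_norm \<beta> \<delta>)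
        + 1/2 * Qfun (\<delta> / \<sigma>) + \<delta> / (2 * sqrt (2 * pi) * \<sigma>) * exp (-(\<delta>^2) / (2 * \<sigma>^2))
        + \<delta>^2 / (2 * \<sigma>^2) * (1 - Qfun ((\<delta> + E) / \<sigma>))
        + 1 / \<beta> * (\<delta> + E + \<sigma> / sqrt (2 * pi) * exp (-(\<delta>^2) / (2 * \<sigma>^2)))
        - 1/2 * ln (2 * pi * exp 1 * \<sigma>^2)"
    and "integrable CS (\<lambda>w. ln (out_density (fst w + snd w)))"
proof -
  let ?e = "exp (-(\<delta>^2) / (2 * \<sigma>^2))"
  let ?A = "\<lambda>w. ennreal ((snd w)\<^sup>2) * indicator {..-\<delta>} (snd w) :: ennreal"
  let ?B = "\<lambda>w. indicator {-\<delta>..} (fst w + snd w) :: ennreal"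
  let ?C = "\<lambda>w. ennreal (snd w - (-\<delta>)) * indicator {-\<delta>..} (snd w) :: ennreal"
  \<comment> \<open>\<open>a\<close>, \<open>b\<close> and \<open>c\<close> bound the integrals of
    \<open>?A\<close>, \<open>?B\<close> and \<open>?C\<close>.\<close>
  define a where "a = \<sigma>\<^sup>2 * Qfun (\<delta> / \<sigma>) + \<delta> * (\<sigma> / sqrt (2 * pi) * ?e)"
  define b where "b = 1 - Qfun ((\<delta> + E) / \<sigma>)"
  define c where "c = \<delta> + \<sigma> / sqrt (2 * pi) * ?e"
  have nonneg: "0 \<le> a" "0 \<le> b" "0 \<le> c"
    using assms \<sigma>_pos Qfun_le_1 by (auto simp: a_def b_def c_def Qfun_nonneg)
  have A: "(\<integral>\<^sup>+w. ?A w \<partial>CS) = ennreal a" unfolding a_def by (rule nn_integral_noise_square_tail)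
  have B: "(\<integral>\<^sup>+w. ?B w \<partial>CS) \<le> ennreal b" unfolding b_def using assms by (intro nn_integral_output_atLeast)
  \<comment> \<open>The exact truncated mean carries
    \<open>\<delta> * Qfun (- \<delta> / \<sigma>)\<close>; relaxing it to \<open>\<delta>\<close>
    gives the form in the theorem.\<close>
  have "\<delta> * Qfun (- \<delta> / \<sigma>) \<le> \<delta> * 1" using assms by (intro mult_left_mono Qfun_le_1)
  then have C: "(\<integral>\<^sup>+w. ?C w \<partial>CS) \<le> ennreal c"
    unfolding nn_integral_noise_linear_tail c_def by (intro ennreal_leI) simp
  have "(\<integral>\<^sup>+w. ennreal (dual_exponent \<beta> \<delta> (fst w + snd w)) \<partial>CS)
     \<le> (\<integral>\<^sup>+w. ennreal (1 / (2 * \<sigma>\<^sup>2)) * ?A w + (ennreal (\<delta>\<^sup>2 / (2 * \<sigma>\<^sup>2)) * ?B w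
          + ennreal (1 / \<beta>) * (ennreal (fst w) + ?C w)) \<partial>CS)"
  proof (rule nn_integral_mono_AE)
    show "AE w in CS. ennreal (dual_exponent \<beta> \<delta> (fst w + snd w)) \<le> ennreal (1 / (2 * \<sigma>\<^sup>2)) * ?A w
      + (ennreal (\<delta>\<^sup>2 / (2 * \<sigma>\<^sup>2)) * ?B w + ennreal (1 / \<beta>) * (ennreal (fst w) + ?C w))"
      using AE_CS_input_nonneg
    proof eventually_elim
      case (elim w)
      obtain x z where w: "w = (x, z)" by (cases w)
      with elim have x: "0 \<le> x" by simp
      show ?case
      proof (cases "x + z < - \<delta>")
        case True
        then have "(x + z)\<^sup>2 \<le> z\<^sup>2"
          using x assms by (intro abs_le_square_iff[THEN iffD1]) auto
        then have "(x + z)\<^sup>2 / (2 * \<sigma>\<^sup>2) \<le> z\<^sup>2 / (2 * \<sigma>\<^sup>2)"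
          by (intro divide_right_mono) auto
        then have "ennreal (dual_exponent \<beta> \<delta> (x + z)) \<le> ennreal (1 / (2 * \<sigma>\<^sup>2)) * ?A w"
          using True x by (auto simp: w dual_exponent_def ennreal_mult'[symmetric] intro!: ennreal_leI)
        then show ?thesis by (auto simp: w intro!: add_increasing2)
      next
        case False
        \<comment> \<open>\<open>?C w\<close> is the positive part of \<open>z + \<delta>\<close>,
          so the claim also covers very negative noise.\<close>
        have "ennreal (x + z + \<delta>) \<le> ennreal x + ?C w"
        proof (cases "- \<delta> \<le> z")
          case True
          then show ?thesis using x by (simp add: w ennreal_plus[symmetric] add.assoc del: ennreal_plus)
        next
          case False
          then show ?thesis by (auto simp: w intro!: ennreal_leI)
        qed
        moreover have "ennreal (dual_exponent \<beta> \<delta> (x + z)) = ennreal (\<delta>\<^sup>2 / (2 * \<sigma>\<^sup>2)) * ?B w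
            + ennreal (1 / \<beta>) * ennreal (x + z + \<delta>)"
          using False assms
          by (simp add: w dual_exponent_def ennreal_mult'[symmetric] ennreal_plus[symmetric] del: ennreal_plus)
        ultimately show ?thesis
          by (auto simp: w intro!: add_increasing add_left_mono mult_left_mono)
      qed
    qed
  qed
  also have "\<dots> = ennreal (1 / (2 * \<sigma>\<^sup>2)) * (\<integral>\<^sup>+w. ?A w \<partial>CS) + (ennreal (\<delta>\<^sup>2 / (2 * \<sigma>\<^sup>2)) * (\<integral>\<^sup>+w. ?B w \<partial>CS)
          + ennreal (1 / \<beta>) * ((\<integral>\<^sup>+w. ennreal (fst w) \<partial>CS) + (\<integral>\<^sup>+w. ?C w \<partial>CS)))"
    by (rule nn_integral_linear_comb4; measurable)
  also have "\<dots> \<le> ennreal (1 / (2 * \<sigma>\<^sup>2)) * ennreal a + (ennreal (\<delta>\<^sup>2 / (2 * \<sigma>\<^sup>2)) * ennreal b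
          + ennreal (1 / \<beta>) * (ennreal E + ennreal c))"
    unfolding A by (intro add_mono mult_left_mono B C nn_integral_CS_input_le) auto
  also have "\<dots> = ennreal (1 / (2 * \<sigma>\<^sup>2) * a + (\<delta>\<^sup>2 / (2 * \<sigma>\<^sup>2) * b + 1 / \<beta> * (E + c)))"
    using assms nonneg E_pos by (simp add: ennreal_mult'[symmetric] ennreal_plus[symmetric] del: ennreal_plus)
  finally have *: "(\<integral>\<^sup>+w. ennreal (dual_exponent \<beta> \<delta> (fst w + snd w)) \<partial>CS) \<le> \<dots>" .
  have v: "1 / (2 * \<sigma>\<^sup>2) * a + (\<delta>\<^sup>2 / (2 * \<sigma>\<^sup>2) * b + 1 / \<beta> * (E + c)) =
     1/2 * Qfun (\<delta> / \<sigma>) + \<delta> / (2 * sqrt (2 * pi) * \<sigma>) * ?e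
        + \<delta>^2 / (2 * \<sigma>^2) * (1 - Qfun ((\<delta> + E) / \<sigma>))
        + 1 / \<beta> * (\<delta> + E + \<sigma> / sqrt (2 * pi) * ?e)"
    using \<sigma>_pos assms unfolding a_def b_def c_def by (simp add: field_simps power2_eq_square)
  show "integrable CS (\<lambda>w. ln (out_density (fst w + snd w)))"
    using assms nonneg E_pos by (intro channel_MI_le_of_dual_exponent(2)[OF _ _ *]) auto
  have "channel_MI \<sigma> P \<le> ln (dual_norm \<beta> \<delta>)
      + (1 / (2 * \<sigma>\<^sup>2) * a + (\<delta>\<^sup>2 / (2 * \<sigma>\<^sup>2) * b + 1 / \<beta> * (E + c))) - 1/2 * ln (2 * pi * exp 1 * \<sigma>\<^sup>2)"
    using assms nonneg E_pos by (intro channel_MI_le_of_dual_exponent(1)[OF _ _ *]) auto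
  then show "channel_MI \<sigma> P \<le> ln (dual_norm \<beta> \<delta>)
        + 1/2 * Qfun (\<delta> / \<sigma>) + \<delta> / (2 * sqrt (2 * pi) * \<sigma>) * ?e
        + \<delta>^2 / (2 * \<sigma>^2) * (1 - Qfun ((\<delta> + E) / \<sigma>))
        + 1 / \<beta> * (\<delta> + E + \<sigma> / sqrt (2 * pi) * ?e)
        - 1/2 * ln (2 * pi * exp 1 * \<sigma>^2)"
    unfolding v by linarith
qed

text \<open>Here the junction \<open>- \<delta>\<close> is positive and the quadratic term is no
  longer monotone in the input. The majorant is \<open>s * z\<^sup>2\<close> everywhere, plus a
  constant for large noise, a term linear in the input for small noise, and
  \<open>(x + max z 0) / \<beta>\<close>. The mean of \<open>s * z\<^sup>2\<close> is 1/2 and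
  cancels against the 1/2 in the noise entropy.\<close>

lemma channel_MI_le_neg:
  assumes "0 < \<beta>" "\<delta> < 0"
  shows "channel_MI \<sigma> P \<le> ln (dual_norm \<beta> \<delta>)
        - ln (sqrt (2 * pi) * \<sigma>) - \<delta> * E / (2 * \<sigma>^2)
        + \<delta>^2 / (2 * \<sigma>^2) * (1 - Qfun (\<delta> / \<sigma>) - E / \<delta> * Qfun (\<delta> / \<sigma>))
        + 1 / \<beta> * (E + \<sigma> / sqrt (2 * pi))"
proof -
  let ?A = "\<lambda>w. indicator {-\<delta>..} (snd w) :: ennreal"
  let ?B = "\<lambda>w. ennreal (fst w) * indicator {..-\<delta>} (snd w) :: ennreal"
  let ?C = "\<lambda>w. ennreal (snd w - 0) * indicator {0..} (snd w) :: ennreal"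
  let ?Q = "Qfun (\<delta> / \<sigma>)"
  have A: "(\<integral>\<^sup>+w. ?A w \<partial>CS) = ennreal (1 - ?Q)"
    using nn_integral_noise_atLeast[of "-\<delta>"] Qfun_minus[of "\<delta> / \<sigma>"] by simp
  have B: "(\<integral>\<^sup>+w. ?B w \<partial>CS) \<le> ennreal (E * ?Q)"
    using nn_integral_input_noise_atMost[of "-\<delta>"] by simp
  have C: "(\<integral>\<^sup>+w. ?C w \<partial>CS) = ennreal (\<sigma> / sqrt (2 * pi))"
    unfolding nn_integral_noise_linear_tail by simp
  define s where "s = 1 / (2 * \<sigma>\<^sup>2)"
  define d where "d = 2 * s * (- \<delta>)"
  define v where "v = s * \<sigma>\<^sup>2 + (s * \<delta>\<^sup>2 * (1 - ?Q) + (d * (E * ?Q) + 1 / \<beta> * (E + \<sigma> / sqrt (2 * pi))))"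
  have s: "0 \<le> s" by (simp add: s_def)
  have d: "0 \<le> d" unfolding d_def using s assms by (intro mult_nonneg_nonneg) auto
  have nonneg: "0 \<le> 1 - ?Q" "0 \<le> E * ?Q" "0 \<le> E + \<sigma> / sqrt (2 * pi)"
    using E_pos \<sigma>_pos Qfun_le_1[of "\<delta> / \<sigma>"] Qfun_nonneg[of "\<delta> / \<sigma>"] by auto
  have "(\<integral>\<^sup>+w. ennreal (dual_exponent \<beta> \<delta> (fst w + snd w)) \<partial>CS)
     \<le> (\<integral>\<^sup>+w. ennreal s * ennreal ((snd w)\<^sup>2) + (ennreal (s * \<delta>\<^sup>2) * ?A w
          + (ennreal (d) * ?B w + ennreal (1 / \<beta>) * (ennreal (fst w) + ?C w))) \<partial>CS)"
  proof (rule nn_integral_mono_AE)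
    show "AE w in CS. ennreal (dual_exponent \<beta> \<delta> (fst w + snd w)) \<le> ennreal s * ennreal ((snd w)\<^sup>2) + (ennreal (s * \<delta>\<^sup>2) * ?A w
          + (ennreal (d) * ?B w + ennreal (1 / \<beta>) * (ennreal (fst w) + ?C w)))"
      using AE_CS_input_nonneg
    proof eventually_elim
      case (elim w)
      obtain x z where w: "w = (x, z)" by (cases w)
      with elim have x: "0 \<le> x" by simp
      define u where "u = s * z\<^sup>2 + (s * \<delta>\<^sup>2 * indicat_real {-\<delta>..} z + (d * (x * indicat_real {..-\<delta>} z)
        + 1 / \<beta> * (x + z * indicat_real {0..} z)))"
      have "dual_exponent \<beta> \<delta> (x + z) \<le> u"
      proof (cases "x + z < - \<delta>")
        case True
        then have "z \<le> - \<delta>" using x by simp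
        \<comment> \<open>\<open>(x + z)\<^sup>2 - z\<^sup>2 = x * (x + 2 * z)\<close>, and both
          \<open>x + z\<close> and \<open>z\<close> are at most \<open>- \<delta>\<close>.\<close>
        have "x * (x + 2 * z) \<le> x * (2 * (- \<delta>))"
          using True x \<open>z \<le> - \<delta>\<close> by (intro mult_left_mono) auto
        then have "(x + z)\<^sup>2 \<le> z\<^sup>2 + 2 * (- \<delta>) * x"
          by (simp add: power2_eq_square algebra_simps)
        then have "s * (x + z)\<^sup>2 \<le> s * (z\<^sup>2 + 2 * (- \<delta>) * x)"
          using s by (rule mult_left_mono)
        also have "\<dots> \<le> u"
        proof -
          have "0 \<le> s * \<delta>\<^sup>2 * indicat_real {-\<delta>..} z" "0 \<le> 1 / \<beta> * (x + z * indicat_real {0..} z)"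
            using s assms x by (auto split: split_indicator)
          then show ?thesis using \<open>z \<le> - \<delta>\<close> by (simp add: u_def d_def algebra_simps)
        qed
        finally show ?thesis using True by (simp add: dual_exponent_def s_def)
      next
        case False
        \<comment> \<open>Dropping the negative number \<open>\<delta>\<close> and the negative part
          of \<open>z\<close> only increases the linear term.\<close>
        have "(x + z + \<delta>) / \<beta> \<le> (x + z * indicat_real {0..} z) / \<beta>"
          using assms x by (intro divide_right_mono) (auto split: split_indicator)
        moreover have "s * \<delta>\<^sup>2 \<le> s * z\<^sup>2 + (s * \<delta>\<^sup>2 * indicat_real {-\<delta>..} z + d * (x * indicat_real {..-\<delta>} z))"
        proof (cases "- \<delta> \<le> z")
          case True
          have "0 \<le> s * z\<^sup>2" using s by simp
          moreover have "0 \<le> d * (x * indicat_real {..-\<delta>} z)"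
            using d x by (intro mult_nonneg_nonneg) auto
          ultimately show ?thesis using True by simp
        next
          case z: False
          \<comment> \<open>\<open>\<delta>\<^sup>2 - z\<^sup>2 = (- \<delta> - z) * (- \<delta> +
            z)\<close>, where the first factor is at most \<open>x\<close> because the output has
            passed the junction. If the second factor is negative, \<open>z\<^sup>2\<close> alone
            suffices.\<close>
          have "\<delta>\<^sup>2 \<le> z\<^sup>2 + 2 * (- \<delta>) * x"
          proof (cases "0 \<le> - \<delta> + z")
            case True
            have "(- \<delta> - z) * (- \<delta> + z) \<le> x * (2 * (- \<delta>))"
              using False z assms True x by (intro mult_mono) auto
            then show ?thesis by (simp add: power2_eq_square algebra_simps)
          next
            case neg: False
            have "(-\<delta>)\<^sup>2 \<le> z\<^sup>2"
              using neg assms by (intro abs_le_square_iff[THEN iffD1]) auto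
            moreover have "0 \<le> 2 * (- \<delta>) * x" using assms x by (intro mult_nonneg_nonneg) auto
            ultimately show ?thesis by simp
          qed
          then have "s * \<delta>\<^sup>2 \<le> s * (z\<^sup>2 + 2 * (- \<delta>) * x)"
            using s by (rule mult_left_mono)
          then show ?thesis using z by (simp add: d_def algebra_simps)
        qed
        ultimately show ?thesis using False by (simp add: dual_exponent_def u_def s_def)
      qed
      then have "ennreal (dual_exponent \<beta> \<delta> (x + z)) \<le> ennreal u" by (rule ennreal_leI)
      also have "ennreal u = ennreal s * ennreal (z\<^sup>2) + (ennreal (s * \<delta>\<^sup>2) * ?A w
          + (ennreal (d) * ?B w + ennreal (1 / \<beta>) * (ennreal x + ?C w)))"
        using s x assms d unfolding u_def w
        by (auto simp: ennreal_mult'[symmetric] ennreal_plus[symmetric] simp del: ennreal_plus split: split_indicator)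
      finally show ?case by (simp add: w)
    qed
  qed
  also have "\<dots> = ennreal s * (\<integral>\<^sup>+w. ennreal ((snd w)\<^sup>2) \<partial>CS) + (ennreal (s * \<delta>\<^sup>2) * (\<integral>\<^sup>+w. ?A w \<partial>CS)
          + (ennreal (d) * (\<integral>\<^sup>+w. ?B w \<partial>CS)
          + ennreal (1 / \<beta>) * ((\<integral>\<^sup>+w. ennreal (fst w) \<partial>CS) + (\<integral>\<^sup>+w. ?C w \<partial>CS))))"
    by (subst nn_integral_add, measurable, subst nn_integral_cmult, measurable)
       (intro arg_cong2[where f="(+)"] refl nn_integral_linear_comb4; measurable)
  also have "\<dots> \<le> ennreal s * ennreal (\<sigma>\<^sup>2) + (ennreal (s * \<delta>\<^sup>2) * ennreal (1 - ?Q)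
          + (ennreal (d) * ennreal (E * ?Q)
          + ennreal (1 / \<beta>) * (ennreal E + ennreal (\<sigma> / sqrt (2 * pi)))))"
    unfolding A C nn_integral_noise_square
    by (intro add_mono mult_left_mono B nn_integral_CS_input_le order_refl) auto
  also have "\<dots> = ennreal v"
    unfolding v_def using nonneg s d assms E_pos \<sigma>_pos
    by (simp add: ennreal_mult'[symmetric] ennreal_plus[symmetric] del: ennreal_plus)
  finally have *: "(\<integral>\<^sup>+w. ennreal (dual_exponent \<beta> \<delta> (fst w + snd w)) \<partial>CS) \<le> ennreal v" .
  have "0 \<le> v"
    unfolding v_def using nonneg s d assms by simp
  then have MI: "channel_MI \<sigma> P \<le> ln (dual_norm \<beta> \<delta>) + v - 1/2 * ln (2 * pi * exp 1 * \<sigma>\<^sup>2)"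
    by (rule channel_MI_le_of_dual_exponent(1)[OF assms(1) _ *])
  have "1/2 * ln (2 * pi * exp 1 * \<sigma>\<^sup>2) = 1/2 + ln (sqrt (2 * pi) * \<sigma>)"
    using \<sigma>_pos by (simp add: ln_mult ln_sqrt power2_eq_square field_simps)
  moreover have "s * \<sigma>\<^sup>2 = 1/2" using \<sigma>_pos by (simp add: s_def)
  \<comment> \<open>The majorant produces \<open>2 * ?Q\<close>; as \<open>?Q \<le> 1\<close>, it is
    relaxed to \<open>1 + ?Q\<close>, which matches the terms of the stated bound.\<close>
  moreover have "d * (E * ?Q) \<le> s * (- \<delta>) * E * (1 + ?Q)"
  proof -
    have "s * (- \<delta>) * E * (2 * ?Q) \<le> s * (- \<delta>) * E * (1 + ?Q)"
      using nonneg s assms E_pos by (intro mult_left_mono mult_nonneg_nonneg) auto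
    then show ?thesis by (simp add: d_def algebra_simps)
  qed
  moreover have "- \<delta> * E / (2 * \<sigma>^2) + \<delta>^2 / (2 * \<sigma>^2) * (1 - ?Q - E / \<delta> * ?Q)
     = s * \<delta>\<^sup>2 * (1 - ?Q) + s * (- \<delta>) * E * (1 + ?Q)"
    using assms \<sigma>_pos unfolding s_def by (simp add: field_simps power2_eq_square)
  ultimately show ?thesis using MI unfolding v_def by linarith
qed

end

subsection \<open>The mean of the logarithm of the Q-function\<close>

text \<open>The function \<open>L\<close> of the overview.\<close>

definition mean_neg_ln_Qfun :: "real \<Rightarrow> real" where
  "mean_neg_ln_Qfun s = (\<integral>n. std_normal_density n * - ln (Qfun (n + s)) \<partial>lborel)"

text \<open>\<open>Qfun u\<close> is at least its drop over the interval from \<open>u\<close> to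
  \<open>u + 1\<close>, which equals the density at an intermediate point. The resulting quadratic
  growth makes the integral in \<open>mean_neg_ln_Qfun\<close> converge.\<close>

lemma neg_ln_Qfun_le: "- ln (Qfun u) \<le> u\<^sup>2 + 1 + ln (2 * pi) / 2"
proof -
  obtain c where c: "u < c" "c < u + 1" "Qfun (u + 1) - Qfun u = (u + 1 - u) * - std_normal_density c"
    using MVT2[of u "u + 1" Qfun "\<lambda>x. - std_normal_density x"] DERIV_Qfun by auto
  have "\<bar>c\<bar> \<le> \<bar>\<bar>u\<bar> + 1\<bar>" using c by auto
  then have "c\<^sup>2 \<le> (\<bar>u\<bar> + 1)\<^sup>2" by (rule abs_le_square_iff[THEN iffD1])
  also have "\<dots> \<le> 2 * (u\<^sup>2 + 1)"
    using sum_squares_ge_zero[of "\<bar>u\<bar> - 1" 0] by (simp add: power2_eq_square algebra_simps)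
  finally have c2: "c\<^sup>2 / 2 \<le> u\<^sup>2 + 1" by simp
  have "std_normal_density c \<le> Qfun u" using c Qfun_nonneg[of "u + 1"] by simp
  then have "ln (std_normal_density c) \<le> ln (Qfun u)"
    by (subst ln_le_cancel_iff) (auto simp: normal_density_pos Qfun_pos)
  moreover have "ln (std_normal_density c) = - c\<^sup>2 / 2 - ln (2 * pi) / 2"
    by (simp add: std_normal_density_def ln_mult ln_div ln_sqrt)
  ultimately show ?thesis using c2 by simp
qed

lemma nn_integral_exp_tail:
  fixes c :: real
  assumes "0 < c"
  shows "(\<integral>\<^sup>+t. ennreal (exp (b - c * t)) * indicator {a..} t \<partial>lborel) = ennreal (exp (b - c * a) / c)"
proof -
  have "((\<lambda>t. - exp (b - c * t) / c) \<longlongrightarrow> 0) at_top" using assms by real_asymp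
  moreover have "DERIV (\<lambda>t. - exp (b - c * t) / c) t :> exp (b - c * t)" for t
    using assms by (auto intro!: derivative_eq_intros)
  ultimately have "(\<integral>\<^sup>+t. ennreal (exp (b - c * t)) * indicator {a..} t \<partial>lborel) = ennreal (0 - (- exp (b - c * a) / c))"
    by (intro nn_integral_FTC_atLeast) auto
  then show ?thesis by simp
qed

lemma integrable_std_normal_quadratic:
  "integrable lborel (\<lambda>n. std_normal_density n * (a + b * n + c * n\<^sup>2))"
  and integral_std_normal_quadratic:
  "(\<integral>n. std_normal_density n * (a + b * n + c * n\<^sup>2) \<partial>lborel) = a + c"
proof -
  have eq: "(\<lambda>n. std_normal_density n * (a + b * n + c * n\<^sup>2)) =
    (\<lambda>n. a * std_normal_density n + b * (std_normal_density n * n) + c * (std_normal_density n * n\<^sup>2))"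
    by (simp add: algebra_simps)
  have 1: "integrable lborel (\<lambda>n. std_normal_density n * n)" "(\<integral>n. std_normal_density n * n \<partial>lborel) = 0"
    using integrable_std_normal_moment[of 1] integral_std_normal_moment_odd[of 0] by auto
  have 2: "integrable lborel (\<lambda>n. std_normal_density n * n\<^sup>2)" "(\<integral>n. std_normal_density n * n\<^sup>2 \<partial>lborel) = 1"
    using integrable_std_normal_moment[of 2] integral_std_normal_moment_even[of 1] by auto
  show "integrable lborel (\<lambda>n. std_normal_density n * (a + b * n + c * n\<^sup>2))"
    unfolding eq using 1 2 by auto
  show "(\<integral>n. std_normal_density n * (a + b * n + c * n\<^sup>2) \<partial>lborel) = a + c"
    unfolding eq using 1 2 by simp
qed

lemma integrable_neg_ln_Qfun:
  "integrable lborel (\<lambda>n. std_normal_density n * - ln (Qfun (n + s)))"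
proof (rule Bochner_Integration.integrable_bound)
  show "integrable lborel (\<lambda>n. std_normal_density n * ((s\<^sup>2 + 1 + ln (2 * pi) / 2) + (2 * s) * n + 1 * n\<^sup>2))"
    by (rule integrable_std_normal_quadratic)
  have "norm (std_normal_density n * - ln (Qfun (n + s)))
      \<le> norm (std_normal_density n * ((s\<^sup>2 + 1 + ln (2 * pi) / 2) + (2 * s) * n + 1 * n\<^sup>2))" for n
  proof -
    have "- ln (Qfun (n + s)) \<le> (s\<^sup>2 + 1 + ln (2 * pi) / 2) + (2 * s) * n + 1 * n\<^sup>2"
      using neg_ln_Qfun_le[of "n + s"] by (simp add: power2_eq_square algebra_simps)
    then show ?thesis
      using ln_Qfun_nonpos[of "n + s"] unfolding norm_mult by (intro mult_left_mono) auto
  qed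
  then show "AE n in lborel. norm (std_normal_density n * - ln (Qfun (n + s)))
      \<le> norm (std_normal_density n * ((s\<^sup>2 + 1 + ln (2 * pi) / 2) + (2 * s) * n + 1 * n\<^sup>2))"
    by simp
qed measurable

lemma nn_integral_neg_ln_Qfun:
  "(\<integral>\<^sup>+n. ennreal (std_normal_density n * - ln (Qfun (n + s))) \<partial>lborel) = ennreal (mean_neg_ln_Qfun s)"
  unfolding mean_neg_ln_Qfun_def
  by (intro nn_integral_eq_integral integrable_neg_ln_Qfun AE_I2 mult_nonneg_nonneg) (auto simp: ln_Qfun_nonpos)

text \<open>Fixing the half line and moving \<open>u\<close> into the integrand prepares for Fubini
  and for pointwise estimates in \<open>u\<close>.\<close>

lemma nn_integral_shifted_normal:
  "(\<integral>\<^sup>+t. ennreal (normal_density (- u) 1 t) * indicator {0..} t \<partial>lborel) = ennreal (Qfun u)"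
  using nn_integral_normal_atLeast[of 1 "-u" 0] by simp

text \<open>Jensen's inequality after an exponential change of measure: the tilt by \<open>a\<close> makes the
  expectation of the Mills ratio explicit.\<close>
lemma mean_neg_ln_Qfun_ge_tilt:
  assumes "0 < s + a"
  shows "ln (s + a) - a\<^sup>2 / 2 + s\<^sup>2 / 2 + 1/2 + ln (2 * pi) / 2 \<le> mean_neg_ln_Qfun s"
proof -
  \<comment> \<open>\<open>W n * Qfun (n + s)\<close> is \<open>exp (a * n)\<close> times the Mills
    ratio at \<open>n + s\<close>; \<open>k\<close> will be its mean.\<close>
  define W where "W n = sqrt (2 * pi) * exp ((s + n)\<^sup>2 / 2 + a * n)" for n
  define k where "k = exp (a\<^sup>2 / 2) / (s + a)"
  have k: "0 < k" using assms by (simp add: k_def)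
  have W: "0 < W n" for n by (simp add: W_def)
  have [measurable]: "W \<in> borel_measurable borel" unfolding W_def by measurable
  define g where "g u t = normal_density (- u) 1 t" for u t :: real
  have [measurable]: "(\<lambda>w. g (f w) (h w)) \<in> borel_measurable M"
    if [measurable]: "f \<in> borel_measurable M" "h \<in> borel_measurable M" for f h and M :: "'z measure"
    unfolding g_def by measurable
  have g: "(\<integral>\<^sup>+t. ennreal (g u t) * indicator {0..} t \<partial>lborel) = ennreal (Qfun u)" for u
    unfolding g_def by (rule nn_integral_shifted_normal)
  have g_nonneg: "0 \<le> g u t" for u t by (simp add: g_def)
  \<comment> \<open>The terms in \<open>n\<close> combine to a normal density with mean
    \<open>a - t\<close>, so integrating over \<open>n\<close> first leaves only an exponential in
    \<open>t\<close>.\<close>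
  have complete_square: "std_normal_density n * W n * g (n + s) t
      = normal_density (a - t) 1 n * exp (a\<^sup>2 / 2 - (s + a) * t)" for n t
    unfolding W_def g_def normal_density_def
    by (simp add: exp_add[symmetric] mult_exp_exp) (simp add: power2_eq_square field_simps)
  have exp_int: "(\<integral>\<^sup>+t. ennreal (exp (a\<^sup>2 / 2 - (s + a) * t)) * indicator {0..} t \<partial>lborel) = ennreal k"
    using nn_integral_exp_tail[OF assms, of "a\<^sup>2 / 2" 0] by (simp add: k_def)
  have "(\<integral>\<^sup>+n. ennreal (std_normal_density n * (W n * Qfun (n + s))) \<partial>lborel)
    = (\<integral>\<^sup>+n. \<integral>\<^sup>+t. ennreal (std_normal_density n * W n) *
         (ennreal (g (n + s) t) * indicator {0..} t) \<partial>lborel \<partial>lborel)"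
    using W by (intro nn_integral_cong, subst nn_integral_cmult)
      (auto simp: g ennreal_mult'[symmetric] less_imp_le mult.assoc)
  also have "\<dots> = (\<integral>\<^sup>+n. \<integral>\<^sup>+t. ennreal (normal_density (a - t) 1 n) *
         (ennreal (exp (a\<^sup>2 / 2 - (s + a) * t)) * indicator {0..} t) \<partial>lborel \<partial>lborel)"
    using W g_nonneg by (intro nn_integral_cong)
      (auto simp: ennreal_mult'[symmetric] complete_square less_imp_le split: split_indicator)
  also have "\<dots> = (\<integral>\<^sup>+t. \<integral>\<^sup>+n. ennreal (normal_density (a - t) 1 n) *
         (ennreal (exp (a\<^sup>2 / 2 - (s + a) * t)) * indicator {0..} t) \<partial>lborel \<partial>lborel)"
    by (rule lborel_pair.Fubini') measurable
  also have "\<dots> = (\<integral>\<^sup>+t. ennreal (exp (a\<^sup>2 / 2 - (s + a) * t)) * indicator {0..} t \<partial>lborel)"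
    by (intro nn_integral_cong) (auto simp: nn_integral_multc nn_integral_eq_integral)
  finally have WQ: "(\<integral>\<^sup>+n. ennreal (std_normal_density n * (W n * Qfun (n + s))) \<partial>lborel) = ennreal k"
    by (simp add: exp_int)
  have WQ_nonneg: "0 \<le> std_normal_density n * (W n * Qfun (n + s))" for n
    using W[of n] by (simp add: Qfun_nonneg less_imp_le)
  have WQ_int: "integrable lborel (\<lambda>n. std_normal_density n * (W n * Qfun (n + s)))"
    and WQ_eq: "(\<integral>n. std_normal_density n * (W n * Qfun (n + s)) \<partial>lborel) = k"
    using nn_integral_eq_integrable[THEN iffD1, OF _ _ _ WQ] WQ_nonneg k by auto
  let ?f = "\<lambda>n. std_normal_density n * (1 - ln k + ln (2 * pi) / 2 + s\<^sup>2 / 2 + (s + a) * n + 1/2 * n\<^sup>2)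
     - std_normal_density n * (W n * Qfun (n + s)) / k"
  have "(\<integral>n. ?f n \<partial>lborel) \<le> mean_neg_ln_Qfun s"
    unfolding mean_neg_ln_Qfun_def
  proof (rule integral_mono)
    show "integrable lborel ?f"
      by (intro Bochner_Integration.integrable_diff integrable_std_normal_quadratic integrable_divide_zero WQ_int)
    show "?f n \<le> std_normal_density n * - ln (Qfun (n + s))" for n
    proof -
      \<comment> \<open>Jensen's inequality in the form \<open>ln y \<le> y - 1\<close> at a
        \<open>y\<close> of mean 1; \<open>ln (W n)\<close> is quadratic in \<open>n\<close> and
        integrates explicitly.\<close>
      have "ln (W n * Qfun (n + s) / k) \<le> W n * Qfun (n + s) / k - 1"
        using W[of n] k Qfun_pos by (intro ln_le_minus_one) auto
      moreover have "ln (W n * Qfun (n + s) / k) = ln (W n) + ln (Qfun (n + s)) - ln k"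
        using W[of n] k Qfun_pos[of "n + s"] by (simp add: ln_mult ln_div)
      moreover have "ln (W n) = ln (2 * pi) / 2 + ((s + n)\<^sup>2 / 2 + a * n)"
        unfolding W_def by (subst ln_mult) (auto simp: ln_sqrt)
      moreover have "(s + n)\<^sup>2 / 2 + a * n = s\<^sup>2 / 2 + (s + a) * n + 1/2 * n\<^sup>2"
        by (simp add: power2_eq_square algebra_simps)
      ultimately have "(1 - ln k + ln (2 * pi) / 2 + s\<^sup>2 / 2 + (s + a) * n + 1/2 * n\<^sup>2) - W n * Qfun (n + s) / k
         \<le> - ln (Qfun (n + s))" by linarith
      then have "std_normal_density n * ((1 - ln k + ln (2 * pi) / 2 + s\<^sup>2 / 2 + (s + a) * n + 1/2 * n\<^sup>2) - W n * Qfun (n + s) / k)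
         \<le> std_normal_density n * - ln (Qfun (n + s))"
        by (rule mult_left_mono) simp
      then show ?thesis by (simp add: right_diff_distrib)
    qed
  qed (rule integrable_neg_ln_Qfun)
  also have "(\<integral>n. ?f n \<partial>lborel) = (1 - ln k + ln (2 * pi) / 2 + s\<^sup>2 / 2 + 1/2) - k / k"
    by (simp only: Bochner_Integration.integral_diff[OF integrable_std_normal_quadratic integrable_divide_zero[OF WQ_int]]
        integral_std_normal_quadratic integral_divide_zero WQ_eq)
  also have "ln k = a\<^sup>2 / 2 - ln (s + a)" using assms by (simp add: k_def ln_div)
  finally show ?thesis using k by simp
qed

text \<open>Log-convexity of the Mills ratio, which is \<open>Qfun u * exp (u\<^sup>2 / 2)\<close> up to a constant.\<close>
lemma ln_Qfun_convex_combination: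
  assumes "0 \<le> l" "0 \<le> m" "l + m = 1"
  shows "ln (Qfun (l * u + m * v)) \<le> l * ln (Qfun u) + m * ln (Qfun v) + l * m * (u - v)\<^sup>2 / 2"
proof -
  define C where "C = exp (l * ln (Qfun u) + m * ln (Qfun v) + l * m * (u - v)\<^sup>2 / 2)"
  have C: "0 < C" by (simp add: C_def)
  have l: "l = 1 - m" using assms by simp
  \<comment> \<open>The log density is quadratic in the shift, so its value at the combined shift
    differs from the combination of values by exactly \<open>l * m * (u - v)\<^sup>2 / 2\<close>.
    Convexity of \<open>exp\<close>, applied to the normalised densities, then gives a bound whose
    integral is \<open>C * (l + m) = C\<close>.\<close>
  have pt: "normal_density (- (l * u + m * v)) 1 t
     \<le> C * l / Qfun u * normal_density (- u) 1 t + C * m / Qfun v * normal_density (- v) 1 t" for t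
  proof -
    define A where "A w = ln (normal_density (- w) 1 t) - ln (Qfun w)" for w
    have expA: "exp (A w) = normal_density (- w) 1 t / Qfun w" for w
      by (simp add: A_def exp_diff normal_density_pos Qfun_pos)
    have ln_n: "ln (normal_density (- w) 1 t) = - ln (2 * pi) / 2 - (w + t)\<^sup>2 / 2" for w
      by (simp add: normal_density_def ln_mult ln_div ln_sqrt add.commute add_divide_distrib)
    have "normal_density (- (l * u + m * v)) 1 t = exp (ln (normal_density (- (l * u + m * v)) 1 t))"
      by (simp add: normal_density_pos)
    also have "ln (normal_density (- (l * u + m * v)) 1 t) =
       (l * ln (Qfun u) + m * ln (Qfun v) + l * m * (u - v)\<^sup>2 / 2) + (l * A u + m * A v)"
      unfolding A_def ln_n l by (simp add: power2_eq_square field_simps)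
    also have "exp \<dots> = C * exp (l * A u + m * A v)" by (simp add: C_def exp_add)
    also have "\<dots> \<le> C * (l * exp (A u) + m * exp (A v))"
      using convex_onD[OF exp_convex, of m "A u" "A v"] assms C
      by (intro mult_left_mono) (auto simp: l)
    finally show ?thesis by (simp add: expA field_simps)
  qed
  have "ennreal (Qfun (l * u + m * v)) \<le> (\<integral>\<^sup>+t. ennreal (C * l / Qfun u) * (ennreal (normal_density (- u) 1 t) * indicator {0..} t)
     + ennreal (C * m / Qfun v) * (ennreal (normal_density (- v) 1 t) * indicator {0..} t) \<partial>lborel)"
    unfolding nn_integral_shifted_normal[symmetric]
  proof (rule nn_integral_mono)
    fix t :: real
    show "ennreal (normal_density (- (l * u + m * v)) 1 t) * indicator {0..} t
      \<le> ennreal (C * l / Qfun u) * (ennreal (normal_density (- u) 1 t) * indicator {0..} t)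
        + ennreal (C * m / Qfun v) * (ennreal (normal_density (- v) 1 t) * indicator {0..} t)"
      using ennreal_leI[OF pt[of t]] C assms Qfun_pos[of u] Qfun_pos[of v]
      by (cases "0 \<le> t")
         (auto simp: ennreal_mult'[symmetric] ennreal_plus[symmetric] simp del: ennreal_plus)
  qed
  also have "\<dots> = ennreal (C * l / Qfun u) * ennreal (Qfun u) + ennreal (C * m / Qfun v) * ennreal (Qfun v)"
    by (subst nn_integral_add, measurable, (subst nn_integral_cmult, measurable)+, simp only: nn_integral_shifted_normal)
  also have "\<dots> = ennreal (C * l + C * m)"
    using C assms Qfun_pos[of u] Qfun_pos[of v]
    by (simp add: ennreal_mult'[symmetric] ennreal_plus[symmetric] del: ennreal_plus)
  also have "C * l + C * m = C" using assms by (simp add: distrib_left[symmetric])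
  finally have "Qfun (l * u + m * v) \<le> C" using C by simp
  then have "ln (Qfun (l * u + m * v)) \<le> ln C" using C Qfun_pos by (subst ln_le_cancel_iff) auto
  then show ?thesis by (simp add: C_def)
qed

text \<open>Substituting \<open>q = Qfun u\<close> turns the integrand into \<open>- ln q\<close>,
  with antiderivative \<open>q - q * ln q\<close>.\<close>

lemma nn_integral_neg_ln_Qfun_tail:
  "(\<integral>\<^sup>+u. ennreal (std_normal_density u * - ln (Qfun u)) * indicator {v..} u \<partial>lborel)
    = ennreal (Qfun v - Qfun v * ln (Qfun v))"
proof -
  have "filterlim Qfun (at_right 0) at_top"
    by (rule tendsto_imp_filterlim_at_right[OF tendsto_Qfun_at_top]) (simp add: Qfun_pos)
  moreover have "((\<lambda>x::real. x * ln x - x) \<longlongrightarrow> 0) (at_right 0)" by real_asymp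
  ultimately have "((\<lambda>v. Qfun v * ln (Qfun v) - Qfun v) \<longlongrightarrow> 0) at_top"
    by (rule filterlim_compose[rotated])
  moreover have "DERIV (\<lambda>v. Qfun v * ln (Qfun v) - Qfun v) u :> std_normal_density u * - ln (Qfun u)" for u
    using Qfun_pos[of u] by (auto intro!: derivative_eq_intros simp: field_simps)
  moreover have "0 \<le> std_normal_density u * - ln (Qfun u)" for u
    using ln_Qfun_nonpos[of u] by (intro mult_nonneg_nonneg) auto
  ultimately have "(\<integral>\<^sup>+u. ennreal (std_normal_density u * - ln (Qfun u)) * indicator {v..} u \<partial>lborel)
    = ennreal (0 - (Qfun v * ln (Qfun v) - Qfun v))"
    by (intro nn_integral_FTC_atLeast) auto
  then show ?thesis by simp
qed

text \<open>\<open>Qfun\<close> of a standard normal variable is uniform on the unit interval, where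
  \<open>- ln\<close> has mean 1. The integrals over \<open>{v..}\<close> are at least
  \<open>Qfun v\<close>, which tends to 1 as \<open>v\<close> tends to minus infinity.\<close>

lemma mean_neg_ln_Qfun_0: "1 \<le> mean_neg_ln_Qfun 0"
proof (rule tendsto_upperbound[OF tendsto_Qfun_at_bot])
  have nonneg: "0 \<le> mean_neg_ln_Qfun 0"
    unfolding mean_neg_ln_Qfun_def
    by (intro integral_nonneg_AE AE_I2 mult_nonneg_nonneg) (auto simp: ln_Qfun_nonpos)
  have "Qfun v \<le> mean_neg_ln_Qfun 0" for v
  proof -
    have "Qfun v * ln (Qfun v) \<le> 0" using Qfun_nonneg ln_Qfun_nonpos by (rule mult_nonneg_nonpos)
    then have "ennreal (Qfun v) \<le> ennreal (Qfun v - Qfun v * ln (Qfun v))" by (intro ennreal_leI) simp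
    also have "\<dots> \<le> (\<integral>\<^sup>+u. ennreal (std_normal_density u * - ln (Qfun (u + 0))) \<partial>lborel)"
      unfolding nn_integral_neg_ln_Qfun_tail[symmetric]
      by (intro nn_integral_mono) (auto split: split_indicator)
    finally show ?thesis unfolding nn_integral_neg_ln_Qfun using nonneg by simp
  qed
  then show "\<forall>\<^sub>F v in at_bot. Qfun v \<le> mean_neg_ln_Qfun 0" by simp
qed simp

text \<open>Chord form, from 0 to \<open>s\<close>, of the concavity of \<open>F\<close>: the
  estimate for \<open>ln (Qfun u)\<close> is averaged over \<open>n\<close>, and the quadratic
  correction is what subtracting \<open>s\<^sup>2 / 2\<close> from \<open>L s\<close>
  produces.\<close>

lemma mean_neg_ln_Qfun_concave:
  assumes "0 \<le> t" "t \<le> 1"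
  shows "(1 - t) * mean_neg_ln_Qfun 0 + t * mean_neg_ln_Qfun s - (1 - t) * t * s\<^sup>2 / 2 \<le> mean_neg_ln_Qfun (t * s)"
proof -
  let ?f = "\<lambda>n. (1 - t) * (std_normal_density n * - ln (Qfun (n + 0))) + t * (std_normal_density n * - ln (Qfun (n + s)))
     - (1 - t) * t * s\<^sup>2 / 2 * std_normal_density n"
  have i0: "integrable lborel (\<lambda>n. (1 - t) * (std_normal_density n * - ln (Qfun (n + 0))))"
    and i1: "integrable lborel (\<lambda>n. t * (std_normal_density n * - ln (Qfun (n + s))))"
    and i2: "integrable lborel (\<lambda>n. (1 - t) * t * s\<^sup>2 / 2 * std_normal_density n)"
    by (intro integrable_mult_right integrable_neg_ln_Qfun integrable_normal_density zero_less_one)+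
  have "(\<integral>n. ?f n \<partial>lborel) \<le> mean_neg_ln_Qfun (t * s)"
    unfolding mean_neg_ln_Qfun_def
  proof (rule integral_mono)
    show "integrable lborel ?f"
      by (intro Bochner_Integration.integrable_diff Bochner_Integration.integrable_add i0 i1 i2)
    show "?f n \<le> std_normal_density n * - ln (Qfun (n + t * s))" for n
    proof -
      have "ln (Qfun ((1 - t) * (n + 0) + t * (n + s))) \<le> (1 - t) * ln (Qfun (n + 0)) + t * ln (Qfun (n + s))
        + (1 - t) * t * ((n + 0) - (n + s))\<^sup>2 / 2"
        using assms by (intro ln_Qfun_convex_combination) auto
      also have "(1 - t) * (n + 0) + t * (n + s) = n + t * s" by (simp add: algebra_simps)
      finally have "(1 - t) * - ln (Qfun (n + 0)) + t * - ln (Qfun (n + s)) - (1 - t) * t * s\<^sup>2 / 2 \<le> - ln (Qfun (n + t * s))"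
        by simp
      then have "std_normal_density n * ((1 - t) * - ln (Qfun (n + 0)) + t * - ln (Qfun (n + s)) - (1 - t) * t * s\<^sup>2 / 2)
        \<le> std_normal_density n * - ln (Qfun (n + t * s))"
        by (rule mult_left_mono) simp
      then show ?thesis by (simp add: algebra_simps)
    qed
  qed (rule integrable_neg_ln_Qfun)
  also have "(\<integral>n. ?f n \<partial>lborel) = (1 - t) * mean_neg_ln_Qfun 0 + t * mean_neg_ln_Qfun s - (1 - t) * t * s\<^sup>2 / 2"
    by (simp only: Bochner_Integration.integral_diff[OF Bochner_Integration.integrable_add[OF i0 i1] i2]
        Bochner_Integration.integral_add[OF i0 i1] integral_mult_right_zero mean_neg_ln_Qfun_def
        integral_normal_density[OF zero_less_one] mult_1_right)
  finally show ?thesis .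
qed

text \<open>Convexity of \<open>ln (s\<^sup>2 + c)\<close> along a chord starting at 0. The number
  \<open>1 + r\<close> exceeds \<open>(1 + t\<^sup>2 * r) * (1 + (1 - t) * r)\<close> by
  \<open>t * r * (1 - t) * (1 - t * r)\<close>, and concavity of \<open>ln\<close> bounds the
  logarithm of the second factor from below.\<close>

lemma ln_quadratic_chord:
  fixes r t :: real
  assumes "0 \<le> r" "r \<le> 1" "0 \<le> t" "t \<le> 1"
  shows "ln (1 + t\<^sup>2 * r) \<le> t * ln (1 + r)"
proof -
  have "(1 - (1 - t)) * ln 1 + (1 - t) * ln (1 + r) \<le> ln ((1 - (1 - t)) *\<^sub>R 1 + (1 - t) *\<^sub>R (1 + r))"
    using assms by (intro concave_onD[OF ln_concave]) auto
  also have "(1 - (1 - t)) *\<^sub>R 1 + (1 - t) *\<^sub>R (1 + r) = 1 + (1 - t) * r" by (simp add: algebra_simps)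
  finally have 1: "(1 - t) * ln (1 + r) \<le> ln (1 + (1 - t) * r)" by simp
  have "0 \<le> t * r * (1 - t) * (1 - t * r)"
    using assms by (intro mult_nonneg_nonneg) (auto intro: mult_le_one)
  then have "(1 + t\<^sup>2 * r) * (1 + (1 - t) * r) \<le> 1 + r"
    by (simp add: power2_eq_square algebra_simps)
  moreover have pos: "0 < 1 + t\<^sup>2 * r" "0 < 1 + (1 - t) * r"
    using assms by (auto intro!: add_pos_nonneg)
  ultimately have "ln ((1 + t\<^sup>2 * r) * (1 + (1 - t) * r)) \<le> ln (1 + r)"
    using assms by (subst ln_le_cancel_iff) (auto intro: mult_pos_pos)
  then have "ln (1 + t\<^sup>2 * r) + ln (1 + (1 - t) * r) \<le> ln (1 + r)"
    using pos by (simp add: ln_mult)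
  then show ?thesis using 1 by (simp add: algebra_simps)
qed

text \<open>The lower bound puts \<open>1/4\<close> divided by this constant in the range of
  \<open>ln_quadratic_chord\<close>; the upper bound serves the range
  \<open>s \<ge> 1/2\<close>.\<close>

lemma exp_1_div_2pi_bounds: "1/4 \<le> exp 1 / (2 * pi)" "exp 1 / (2 * pi) \<le> 1/2"
proof -
  show "1/4 \<le> exp 1 / (2 * pi)"
    using pi_less_4 exp_ge_add_one_self[of 1] by (simp add: field_simps)
  show "exp 1 / (2 * pi) \<le> 1/2"
    using pi_gt3 e_less_272 by (simp add: field_simps)
qed

lemma mean_neg_ln_Qfun_ge_large:
  assumes "1/2 \<le> s"
  shows "ln (s\<^sup>2 + exp 1 / (2 * pi)) / 2 + s\<^sup>2 / 2 + 1/2 + ln (2 * pi) / 2 \<le> mean_neg_ln_Qfun s"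
proof -
  \<comment> \<open>The maximiser of \<open>ln (s + a) - a\<^sup>2 / 2\<close> over positive
    \<open>a\<close>, that is, the positive root of \<open>a * (s + a) = 1\<close>. It gives
    \<open>s = 1 / a - a\<close>, so the claim becomes one about \<open>a\<^sup>2\<close>.\<close>
  define a where "a = (sqrt (s\<^sup>2 + 4) - s) / 2"
  have "sqrt (s\<^sup>2) < sqrt (s\<^sup>2 + 4)" by (subst real_sqrt_less_iff) simp
  then have a: "0 < a" using assms by (simp add: a_def)
  have "2 * a + s = sqrt (s\<^sup>2 + 4)" by (simp add: a_def field_simps)
  then have "(2 * a + s)\<^sup>2 = s\<^sup>2 + 4" by simp
  then have eq: "a * (s + a) = 1" by (simp add: power2_eq_square algebra_simps)
  then have sa: "s + a = 1 / a" "s = 1 / a - a" using a by (auto simp: field_simps)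
  \<comment> \<open>Otherwise \<open>a \<ge> 2/3\<close>, hence \<open>a * s \<ge> 1/3\<close>, and
    adding \<open>a\<^sup>2 > 2/3\<close> contradicts \<open>a * (s + a) = 1\<close>.\<close>
  have a2: "a\<^sup>2 \<le> 2/3"
  proof (rule ccontr)
    assume *: "\<not> a\<^sup>2 \<le> 2/3"
    have "2/3 \<le> a"
    proof (rule ccontr)
      assume "\<not> 2/3 \<le> a"
      then have "a * a \<le> 2/3 * (2/3)" using a by (intro mult_mono) auto
      then show False using * by (simp add: power2_eq_square)
    qed
    moreover have "a * (1/2) \<le> a * s" using assms a by (intro mult_left_mono) auto
    ultimately have "1 < a * s + a\<^sup>2" using * by linarith
    then show False using eq by (simp add: power2_eq_square algebra_simps)
  qed
  \<comment> \<open>After substituting for \<open>s\<close> the goal is that this is at most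
    \<open>exp (- a\<^sup>2)\<close>. The square of \<open>1 - a\<^sup>2 / 2\<close> is interposed;
    with the constant replaced by 1/2, the comparison amounts to
    \<open>a\<^sup>2 \<le> 2/3\<close>.\<close>
  have "(1 - a\<^sup>2)\<^sup>2 + exp 1 / (2 * pi) * a\<^sup>2 \<le> (1 - a\<^sup>2)\<^sup>2 + 1/2 * a\<^sup>2"
    by (intro add_left_mono mult_right_mono exp_1_div_2pi_bounds) simp
  also have "\<dots> \<le> (1 - a\<^sup>2 / 2)\<^sup>2"
  proof -
    have "a\<^sup>2 * a\<^sup>2 \<le> a\<^sup>2 * (2/3)" using a2 by (intro mult_left_mono) auto
    then show ?thesis by (simp add: power2_eq_square algebra_simps)
  qed
  also have "\<dots> \<le> (exp (- a\<^sup>2 / 2))\<^sup>2"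
    using exp_ge_add_one_self[of "- a\<^sup>2 / 2"] a2 by (intro power_mono) auto
  also have "\<dots> = exp (- a\<^sup>2)" by (simp add: exp_double[symmetric])
  finally have "((1 - a\<^sup>2)\<^sup>2 + exp 1 / (2 * pi) * a\<^sup>2) / a\<^sup>2 \<le> exp (- a\<^sup>2) / a\<^sup>2"
    by (rule divide_right_mono) simp
  also have "((1 - a\<^sup>2)\<^sup>2 + exp 1 / (2 * pi) * a\<^sup>2) / a\<^sup>2 = s\<^sup>2 + exp 1 / (2 * pi)"
  proof -
    have "(1 - a\<^sup>2)\<^sup>2 / a\<^sup>2 = s\<^sup>2" using a by (simp add: sa(2) field_simps power2_eq_square)
    then show ?thesis using a by (simp add: add_divide_distrib)
  qed
  finally have "ln (s\<^sup>2 + exp 1 / (2 * pi)) \<le> ln (exp (- a\<^sup>2) / a\<^sup>2)"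
    using a by (subst ln_le_cancel_iff) (auto intro!: add_nonneg_pos)
  also have "\<dots> = 2 * (ln (1 / a) - a\<^sup>2 / 2)" using a by (simp add: ln_div ln_realpow)
  also have "1 / a = s + a" using sa by simp
  finally show ?thesis using mean_neg_ln_Qfun_ge_tilt[of s a] a assms by simp
qed

lemma mean_neg_ln_Qfun_ge:
  assumes "0 < s"
  shows "ln (s\<^sup>2 + exp 1 / (2 * pi)) / 2 + s\<^sup>2 / 2 + 1/2 + ln (2 * pi) / 2 \<le> mean_neg_ln_Qfun s"
proof (cases "1/2 \<le> s")
  case True
  then show ?thesis by (rule mean_neg_ln_Qfun_ge_large)
next
  case False
  define c where "c = exp 1 / (2 * pi)"
  \<comment> \<open>The relative position of \<open>s\<close> between 0 and 1/2.\<close>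
  define t where "t = 2 * s"
  have t: "0 \<le> t" "t \<le> 1" "s = t * (1/2)" using assms False by (auto simp: t_def)
  have c: "1/4 \<le> c" using exp_1_div_2pi_bounds by (simp add: c_def)
  have ln_c: "ln c = 1 - ln (2 * pi)" by (simp add: c_def ln_div)
  have ln_add: "ln (u + c) = ln c + ln (1 + u / c)" if "0 \<le> u" for u
  proof -
    have "u + c = c * (1 + u / c)" using c by (simp add: field_simps)
    moreover have "0 < 1 + u / c" using c that by (simp add: add_pos_nonneg)
    ultimately show ?thesis using c by (simp add: ln_mult)
  qed
  have "ln (1 + t\<^sup>2 * (1/4 / c)) \<le> t * ln (1 + 1/4 / c)"
    using c t by (intro ln_quadratic_chord) (auto simp: field_simps)
  then have "ln (s\<^sup>2 + c) \<le> ln c + t * ln (1 + 1/4 / c)"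
    by (subst ln_add) (auto simp: t(3) power_mult_distrib power2_eq_square)
  also have "ln (1 + 1/4 / c) = ln ((1/2)\<^sup>2 + c) - ln c"
    by (subst ln_add) (auto simp: power2_eq_square)
  finally have A: "ln (s\<^sup>2 + c) / 2 \<le> (1 - t) * (ln c / 2) + t * (ln ((1/2)\<^sup>2 + c) / 2)"
    by (simp add: field_simps)
  have B: "ln ((1/2)\<^sup>2 + c) / 2 + 1/8 + 1/2 + ln (2 * pi) / 2 \<le> mean_neg_ln_Qfun (1/2)"
    using mean_neg_ln_Qfun_ge_large[of "1/2"] by (simp add: c_def power2_eq_square)
  have "(1 - t) * (ln c / 2 + 1/2 + ln (2 * pi) / 2) \<le> (1 - t) * mean_neg_ln_Qfun 0"
  proof (rule mult_left_mono)
    \<comment> \<open>At the left endpoint the bound takes the value 1, the mean of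
      \<open>- ln\<close> of a uniform variable.\<close>
    have "ln c / 2 + 1/2 + ln (2 * pi) / 2 = 1" by (simp add: ln_c field_simps)
    then show "ln c / 2 + 1/2 + ln (2 * pi) / 2 \<le> mean_neg_ln_Qfun 0" using mean_neg_ln_Qfun_0 by simp
  qed (use t in simp)
  moreover have "t * (ln ((1/2)\<^sup>2 + c) / 2 + 1/8 + 1/2 + ln (2 * pi) / 2) \<le> t * mean_neg_ln_Qfun (1/2)"
    using t B by (intro mult_left_mono)
  moreover have "(1 - t) * mean_neg_ln_Qfun 0 + t * mean_neg_ln_Qfun (1/2) - (1 - t) * t * (1/2)\<^sup>2 / 2 \<le> mean_neg_ln_Qfun s"
    unfolding t(3) using t by (intro mean_neg_ln_Qfun_concave) auto
  ultimately have C: "(1 - t) * (ln c / 2 + 1/2 + ln (2 * pi) / 2) +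
     t * (ln ((1/2)\<^sup>2 + c) / 2 + 1/8 + 1/2 + ln (2 * pi) / 2) - (1 - t) * t * (1/2)\<^sup>2 / 2 \<le> mean_neg_ln_Qfun s"
    by linarith
  \<comment> \<open>The quadratic terms match:
    \<open>t / 8 - (1 - t) * t / 8 = t\<^sup>2 / 8 = s\<^sup>2 / 2\<close>.\<close>
  have "(1 - t) * (ln c / 2 + 1/2 + ln (2 * pi) / 2) +
     t * (ln ((1/2)\<^sup>2 + c) / 2 + 1/8 + 1/2 + ln (2 * pi) / 2) - (1 - t) * t * (1/2)\<^sup>2 / 2
     = (1 - t) * (ln c / 2) + t * (ln ((1/2)\<^sup>2 + c) / 2) + s\<^sup>2 / 2 + 1/2 + ln (2 * pi) / 2"
    by (simp add: t(3) power2_eq_square field_simps)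
  then show ?thesis using A C unfolding c_def by linarith
qed

subsection \<open>Exponential input\<close>

lemma nn_integral_exponential_density_id:
  assumes "0 < E"
  shows "(\<integral>\<^sup>+x. ennreal x \<partial>density lborel (exponential_density (1 / E))) = ennreal E"
proof -
  have "(\<integral>\<^sup>+x. ennreal x \<partial>density lborel (exponential_density (1 / E)))
     = (\<integral>\<^sup>+x. ennreal (exponential_density (1 / E) x) * ennreal x \<partial>lborel)"
    by (rule nn_integral_density) auto
  also have "\<dots> = (\<integral>\<^sup>+x. ennreal (erlang_density 0 (1 / E) x * x ^ 1) \<partial>lborel)"
    using assms by (intro nn_integral_cong) (auto simp: ennreal_mult'[symmetric])
  also have "\<dots> = ennreal E"
    using assms by (subst nn_integral_erlang_ith_moment) auto
  finally show ?thesis .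
qed

lemma optical_channel_exponential:
  assumes "0 < \<sigma>" "0 < E"
  shows "optical_channel (density lborel (exponential_density (1 / E))) \<sigma> E"
proof -
  have [measurable]: "exponential_density (1 / E) \<in> borel_measurable borel"
    by measurable
  interpret prob_space "density lborel (exponential_density (1 / E))"
    using assms by (intro prob_space_exponential_density) simp
  have "AE x in density lborel (exponential_density (1 / E)). 0 \<le> x"
    by (subst AE_density) (auto simp: exponential_density_def)
  then show ?thesis
    using assms by unfold_locales (simp_all add: nn_integral_exponential_density_id)
qed

locale exponential_input =
  fixes \<sigma> E :: real
  assumes \<sigma>_pos': "0 < \<sigma>" and E_pos': "0 < E"
begin

abbreviation exp_input :: "real measure" where
  "exp_input \<equiv> density lborel (exponential_density (1 / E))"

sublocale optical_channel exp_input \<sigma> E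
  by (rule optical_channel_exponential[OF \<sigma>_pos' E_pos'])

text \<open>Completing the square in \<open>x\<close>: the exponential factor shifts the Gaussian
  mean to \<open>y - \<sigma>\<^sup>2 / E\<close>, and the restriction to \<open>x \<ge> 0\<close>
  leaves a value of \<open>Qfun\<close>.\<close>

lemma out_density_exponential:
  "out_density y = 1 / E * exp (- y / E + (\<sigma> / E)\<^sup>2 / 2) * Qfun (\<sigma> / E - y / \<sigma>)"
proof -
  let ?m = "y - \<sigma>\<^sup>2 / E" and ?C = "1 / E * exp (- y / E + (\<sigma> / E)\<^sup>2 / 2)"
  have pt: "1 / E * exp (- x * (1 / E)) * normal_density x \<sigma> y = ?C * normal_density ?m \<sigma> x" for x
  proof -
    have "- x * (1 / E) + - (y - x)\<^sup>2 / (2 * \<sigma>\<^sup>2) = (- y / E + (\<sigma> / E)\<^sup>2 / 2) + - (x - ?m)\<^sup>2 / (2 * \<sigma>\<^sup>2)"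
      using E_pos \<sigma>_pos by (simp add: field_simps power2_eq_square)
    then have "exp (- x * (1 / E)) * exp (- (y - x)\<^sup>2 / (2 * \<sigma>\<^sup>2))
       = exp (- y / E + (\<sigma> / E)\<^sup>2 / 2) * exp (- (x - ?m)\<^sup>2 / (2 * \<sigma>\<^sup>2))"
      by (simp only: exp_add[symmetric])
    then show ?thesis by (simp add: normal_density_def)
  qed
  have "ennreal (out_density y) = (\<integral>\<^sup>+x. ennreal (exponential_density (1 / E) x) * ennreal (normal_density x \<sigma> y) \<partial>lborel)"
    unfolding nn_integral_out_density by (rule nn_integral_density) auto
  also have "\<dots> = (\<integral>\<^sup>+x. ennreal ?C * (ennreal (normal_density ?m \<sigma> x) * indicator {0..} x) \<partial>lborel)"
  proof (rule nn_integral_cong)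
    fix x :: real
    have "exponential_density (1 / E) x * normal_density x \<sigma> y = ?C * normal_density ?m \<sigma> x * indicator {0..} x"
      using pt[of x] by (auto simp: exponential_density_def)
    then show "ennreal (exponential_density (1 / E) x) * ennreal (normal_density x \<sigma> y)
      = ennreal ?C * (ennreal (normal_density ?m \<sigma> x) * indicator {0..} x)"
      using E_pos by (simp add: ennreal_mult'[symmetric] exponential_density_nonneg ennreal_indicator[symmetric] mult.assoc)
  qed
  also have "\<dots> = ennreal ?C * (\<integral>\<^sup>+x. ennreal (normal_density ?m \<sigma> x) * indicator {0..} x \<partial>lborel)"
    by (rule nn_integral_cmult) measurable
  also have "\<dots> = ennreal ?C * ennreal (Qfun (\<sigma> / E - y / \<sigma>))"
    using nn_integral_normal_atLeast[OF \<sigma>_pos, of ?m 0] \<sigma>_pos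
    by (simp add: diff_divide_distrib power2_eq_square)
  also have "\<dots> = ennreal (?C * Qfun (\<sigma> / E - y / \<sigma>))"
    using E_pos by (simp add: ennreal_mult'[symmetric])
  finally show ?thesis
    using E_pos Qfun_nonneg out_density_pos[of y] by (simp add: less_imp_le)
qed

text \<open>The integration by parts of the overview, carried out for nonnegative functions by
  exchanging integrals. In the variable \<open>v = s - y / \<sigma>\<close> the summand 1 completes
  the integrand to \<open>Qfun v - Qfun v * ln (Qfun v)\<close>, a tail integral; after the exchange
  an exponential in \<open>v\<close> remains, which tilts the Gaussian by \<open>s\<close>.\<close>

lemma nn_integral_neg_ln_Qfun_output:
  "(\<integral>\<^sup>+w. ennreal (1 - ln (Qfun (\<sigma> / E - (fst w + snd w) / \<sigma>))) \<partial>CS) = ennreal (mean_neg_ln_Qfun (\<sigma> / E))"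
proof -
  define s where "s = \<sigma> / E"
  have s: "0 < s" using E_pos \<sigma>_pos by (simp add: s_def)
  let ?g = "\<lambda>v. s * exp (s * v - s\<^sup>2 / 2)"
  define h where "h u = std_normal_density u * - ln (Qfun u)" for u
  have [measurable]: "h \<in> borel_measurable borel" unfolding h_def by measurable
  have [measurable]: "Measurable.pred (borel \<Otimes>\<^sub>M borel) (\<lambda>p::real\<times>real. fst p \<in> {snd p..})"
    unfolding atLeast_iff by measurable
  have h: "0 \<le> h u" for u unfolding h_def using ln_Qfun_nonpos[of u] by (intro mult_nonneg_nonneg) auto
  have "(\<integral>\<^sup>+w. ennreal (1 - ln (Qfun (s - (fst w + snd w) / \<sigma>))) \<partial>CS)
     = (\<integral>\<^sup>+y. ennreal (out_density y) * ennreal (1 - ln (Qfun (s - y / \<sigma>))) \<partial>lborel)"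
    by (rule nn_integral_output) measurable
  also have "\<dots> = ennreal \<bar>-\<sigma>\<bar> * (\<integral>\<^sup>+v. ennreal (out_density (\<sigma> * s + (-\<sigma>) * v)) * ennreal (1 - ln (Qfun (s - (\<sigma> * s + (-\<sigma>) * v) / \<sigma>))) \<partial>lborel)"
    using \<sigma>_pos by (intro nn_integral_real_affine) auto
  also have "\<dots> = (\<integral>\<^sup>+v. ennreal \<sigma> * (ennreal (out_density (\<sigma> * s + (-\<sigma>) * v)) * ennreal (1 - ln (Qfun (s - (\<sigma> * s + (-\<sigma>) * v) / \<sigma>)))) \<partial>lborel)"
    using \<sigma>_pos by (subst nn_integral_cmult) auto
  also have "\<dots> = (\<integral>\<^sup>+v. ennreal (?g v) * ennreal (Qfun v - Qfun v * ln (Qfun v)) \<partial>lborel)"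
  proof (rule nn_integral_cong)
    fix v :: real
    have v: "s - (\<sigma> * s + (-\<sigma>) * v) / \<sigma> = v" using \<sigma>_pos by (simp add: field_simps)
    have e: "- (\<sigma> * s + (-\<sigma>) * v) / E + s\<^sup>2 / 2 = s * v - s\<^sup>2 / 2"
      using E_pos by (simp add: s_def field_simps power2_eq_square)
    have "out_density (\<sigma> * s + (-\<sigma>) * v) = 1 / E * exp (s * v - s\<^sup>2 / 2) * Qfun v"
      unfolding out_density_exponential s_def[symmetric] v e ..
    then show "ennreal \<sigma> * (ennreal (out_density (\<sigma> * s + (-\<sigma>) * v)) * ennreal (1 - ln (Qfun (s - (\<sigma> * s + (-\<sigma>) * v) / \<sigma>))))
       = ennreal (?g v) * ennreal (Qfun v - Qfun v * ln (Qfun v))"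
      unfolding v using E_pos \<sigma>_pos s Qfun_nonneg[of v]
      by (simp add: ennreal_mult'[symmetric]) (simp add: s_def field_simps)
  qed
  also have "\<dots> = (\<integral>\<^sup>+v. \<integral>\<^sup>+u. ennreal (?g v) * (ennreal (h u) * indicator {v..} u) \<partial>lborel \<partial>lborel)"
    unfolding nn_integral_neg_ln_Qfun_tail[symmetric] h_def
    by (intro nn_integral_cong nn_integral_cmult[symmetric]) measurable
  also have "\<dots> = (\<integral>\<^sup>+u. \<integral>\<^sup>+v. ennreal (?g v) * (ennreal (h u) * indicator {v..} u) \<partial>lborel \<partial>lborel)"
    by (rule lborel_pair.Fubini') measurable
  also have "\<dots> = (\<integral>\<^sup>+u. ennreal (std_normal_density (- s + u) * - ln (Qfun (- s + u + s))) \<partial>lborel)"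
  proof (rule nn_integral_cong)
    fix u :: real
    have "(\<integral>\<^sup>+v. ennreal (?g v) * (ennreal (h u) * indicator {v..} u) \<partial>lborel)
      = (\<integral>\<^sup>+v. ennreal (s * h u) * (ennreal (exp (s * v - s\<^sup>2 / 2)) * indicator {..u} v) \<partial>lborel)"
      using s h[of u] by (intro nn_integral_cong) (auto simp: ennreal_mult'[symmetric] mult_ac split: split_indicator)
    also have "\<dots> = ennreal (s * h u) * (\<integral>\<^sup>+v. ennreal (exp (s * v - s\<^sup>2 / 2)) * indicator {..u} v \<partial>lborel)"
      by (rule nn_integral_cmult) measurable
    also have "(\<integral>\<^sup>+v. ennreal (exp (s * v - s\<^sup>2 / 2)) * indicator {..u} v \<partial>lborel)
      = (\<integral>\<^sup>+v. ennreal (exp (- s\<^sup>2 / 2 - s * v)) * indicator {-u..} v \<partial>lborel)"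
      by (subst nn_integral_lborel_reflect) (auto intro!: nn_integral_cong split: split_indicator)
    also have "\<dots> = ennreal (exp (- s\<^sup>2 / 2 - s * (- u)) / s)" by (rule nn_integral_exp_tail[OF s])
    also have "ennreal (s * h u) * \<dots> = ennreal (h u * exp (- s\<^sup>2 / 2 + s * u))"
    proof -
      have "0 \<le> s * h u" using s h[of u] by (intro mult_nonneg_nonneg) auto
      then have "ennreal (s * h u) * ennreal (exp (- s\<^sup>2 / 2 - s * (- u)) / s)
        = ennreal (s * h u * (exp (- s\<^sup>2 / 2 - s * (- u)) / s))"
        by (rule ennreal_mult'[symmetric])
      also have "s * h u * (exp (- s\<^sup>2 / 2 - s * (- u)) / s) = h u * exp (- s\<^sup>2 / 2 + s * u)"
        using s by simp
      finally show ?thesis .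
    qed
    also have "h u * exp (- s\<^sup>2 / 2 + s * u) = std_normal_density (- s + u) * - ln (Qfun u)"
    proof -
      \<comment> \<open>The tilt by \<open>exp (s * u - s\<^sup>2 / 2)\<close> moves the mean of the
        standard normal density to \<open>s\<close>.\<close>
      have "- u\<^sup>2 / 2 + (- s\<^sup>2 / 2 + s * u) = - (- s + u)\<^sup>2 / 2" by (simp add: power2_eq_square field_simps)
      then have "std_normal_density u * exp (- s\<^sup>2 / 2 + s * u) = std_normal_density (- s + u)"
        by (simp add: std_normal_density_def exp_add[symmetric])
      then show ?thesis unfolding h_def by (metis mult.assoc mult.commute)
    qed
    finally show "(\<integral>\<^sup>+v. ennreal (?g v) * (ennreal (h u) * indicator {v..} u) \<partial>lborel)
      = ennreal (std_normal_density (- s + u) * - ln (Qfun (- s + u + s)))" by simp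
  qed
  also have "\<dots> = (\<integral>\<^sup>+n. ennreal (std_normal_density n * - ln (Qfun (n + s))) \<partial>lborel)"
    using nn_integral_real_affine[of "\<lambda>n. ennreal (std_normal_density n * - ln (Qfun (n + s)))" 1 "-s"]
    by simp
  also have "\<dots> = ennreal (mean_neg_ln_Qfun s)" by (rule nn_integral_neg_ln_Qfun)
  finally show ?thesis by (simp add: s_def)
qed

lemma channel_MI_exponential_ge:
  "1/2 * ln (1 + E^2 * exp 1 / (2 * pi * \<sigma>^2)) \<le> channel_MI \<sigma> exp_input"
proof -
  define s where "s = \<sigma> / E"
  have s: "0 < s" using E_pos \<sigma>_pos by (simp add: s_def)
  let ?Y = "\<lambda>w::real\<times>real. fst w + snd w"
  have ln_out: "ln (out_density y) = - ln E - y / E + s\<^sup>2 / 2 + ln (Qfun (s - y / \<sigma>))" for y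
    using E_pos Qfun_pos[of "s - y / \<sigma>"] by (simp add: out_density_exponential s_def[symmetric] ln_mult ln_div)
  have int: "integrable CS (\<lambda>w. ln (out_density (?Y w)))"
    \<comment> \<open>The test density with \<open>\<beta> = 1\<close> and
      \<open>\<delta> = 0\<close> supplies finiteness of the output entropy.\<close>
    by (rule channel_MI_le_nonneg(2)[of 1 0]) auto
  have fst_int: "integrable CS fst" and fst_eq: "(\<integral>w. fst w \<partial>CS) = E"
    using nn_integral_eq_integrable[THEN iffD1, of fst CS E] AE_CS_input_nonneg E_pos
      nn_integral_exponential_density_id[OF E_pos] nn_integral_input[of ennreal] by auto
  have snd_int: "integrable CS snd" and snd_eq: "(\<integral>w. snd w \<partial>CS) = 0"
    using integrable_noise[of "\<lambda>z. z"] integrable_normal_moment[OF \<sigma>_pos, of 0 1]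
      integral_normal_moment_odd[OF \<sigma>_pos, of 0 0] by auto
  have Q_int: "integrable CS (\<lambda>w. 1 - ln (Qfun (s - ?Y w / \<sigma>)))"
  proof -
    have "integrable CS (\<lambda>w. 1 - (ln (out_density (?Y w)) + ln E + ?Y w / E - s\<^sup>2 / 2))"
      using int fst_int snd_int by auto
    then show ?thesis by (simp add: ln_out)
  qed
  have nonneg: "0 \<le> 1 - ln (Qfun y)" for y using ln_Qfun_nonpos[of y] by linarith
  have L_nonneg: "0 \<le> mean_neg_ln_Qfun s"
    unfolding mean_neg_ln_Qfun_def
    by (intro integral_nonneg_AE AE_I2 mult_nonneg_nonneg) (auto simp: ln_Qfun_nonpos)
  have "ennreal (\<integral>w. 1 - ln (Qfun (s - ?Y w / \<sigma>)) \<partial>CS) = ennreal (mean_neg_ln_Qfun s)"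
    using nn_integral_neg_ln_Qfun_output Q_int nonneg
    by (subst nn_integral_eq_integral[symmetric]) (auto simp: s_def)
  then have Q_eq: "(\<integral>w. 1 - ln (Qfun (s - ?Y w / \<sigma>)) \<partial>CS) = mean_neg_ln_Qfun s"
    using L_nonneg nonneg by (subst (asm) ennreal_inj) (auto intro!: integral_nonneg_AE)
  have "(\<integral>w. ln (out_density (?Y w)) \<partial>CS)
     = (\<integral>w. (1 - ln E + s\<^sup>2 / 2) - (fst w + snd w) / E - (1 - ln (Qfun (s - ?Y w / \<sigma>))) \<partial>CS)"
    unfolding ln_out by (intro Bochner_Integration.integral_cong) (auto simp: algebra_simps)
  \<comment> \<open>The noise has mean 0 and the input mean \<open>E\<close>, so the output divided
    by \<open>E\<close> has mean 1.\<close>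
  also have "\<dots> = (1 - ln E + s\<^sup>2 / 2) - E / E - mean_neg_ln_Qfun s"
    using fst_int snd_int Q_int Q_eq fst_eq snd_eq
    by (subst Bochner_Integration.integral_diff) auto
  finally have "- (\<integral>w. ln (out_density (?Y w)) \<partial>CS) = ln E - s\<^sup>2 / 2 + mean_neg_ln_Qfun s"
    using E_pos by simp
  then have MI: "channel_MI \<sigma> exp_input = ln E - s\<^sup>2 / 2 + mean_neg_ln_Qfun s - 1/2 * ln (2 * pi * exp 1 * \<sigma>\<^sup>2)"
    unfolding channel_MI_eq_entropy_diff[OF int] by simp
  have "1/2 * ln (2 * pi * exp 1 * \<sigma>\<^sup>2) = 1/2 + ln (2 * pi) / 2 + ln \<sigma>"
    using \<sigma>_pos by (simp add: ln_mult ln_realpow field_simps)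
  moreover have "ln (1 + E^2 * exp 1 / (2 * pi * \<sigma>^2)) = ln (s\<^sup>2 + exp 1 / (2 * pi)) + 2 * ln E - 2 * ln \<sigma>"
  proof -
    \<comment> \<open>Factoring out \<open>E\<^sup>2 / \<sigma>\<^sup>2\<close> reduces the claim to
      \<open>mean_neg_ln_Qfun_ge\<close>.\<close>
    have "1 + E^2 * exp 1 / (2 * pi * \<sigma>^2) = (s\<^sup>2 + exp 1 / (2 * pi)) * E\<^sup>2 / \<sigma>\<^sup>2"
      using E_pos \<sigma>_pos by (simp add: s_def field_simps power2_eq_square)
    moreover have "0 < s\<^sup>2 + exp 1 / (2 * pi)" by (intro add_nonneg_pos) auto
    ultimately show ?thesis using E_pos \<sigma>_pos by (simp add: ln_mult ln_div ln_realpow)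
  qed
  ultimately show ?thesis using mean_neg_ln_Qfun_ge[OF s] unfolding MI by linarith
qed

end

section \<open>From single inputs to the capacity\<close>

lemma admissible_input_imp_optical_channel:
  assumes "admissible_input E P" "0 < \<sigma>" "0 < E"
  shows "optical_channel P \<sigma> E"
proof -
  interpret prob_space P using assms by (simp add: admissible_input_def)
  show ?thesis by unfold_locales (use assms in \<open>auto simp: admissible_input_def\<close>)
qed

lemma admissible_input_exponential:
  assumes "0 < E"
  shows "admissible_input E (density lborel (exponential_density (1 / E)))"
proof -
  interpret optical_channel "density lborel (exponential_density (1 / E))" 1 E
    using assms by (intro optical_channel_exponential) auto
  show ?thesis
    unfolding admissible_input_def using prob_space_axioms input_nonneg input_mean by auto
qed

text \<open>The exponential input shows that the supremum is over a nonempty set, as the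
  least-upper-bound rule on the reals demands.\<close>

lemma capacity_le:
  assumes "0 < E" "\<And>P. admissible_input E P \<Longrightarrow> channel_MI \<sigma> P \<le> B"
  shows "capacity \<sigma> E \<le> B"
  unfolding capacity_def using assms admissible_input_exponential[OF assms(1)]
  by (intro cSup_least) auto

text \<open>A real supremum dominates its members only when the set is bounded above; the duality
  bound at \<open>\<beta> = 1\<close>, \<open>\<delta> = 0\<close> is uniform in the input
  law.\<close>

lemma channel_MI_le_capacity:
  assumes "0 < \<sigma>" "0 < E" "admissible_input E P"
  shows "channel_MI \<sigma> P \<le> capacity \<sigma> E"
  unfolding capacity_def
proof (rule cSup_upper)
  show "channel_MI \<sigma> P \<in> channel_MI \<sigma> ` {P. admissible_input E P}" using assms by auto
  show "bdd_above (channel_MI \<sigma> ` {P. admissible_input E P})"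
    using optical_channel.channel_MI_le_nonneg(1)[OF admissible_input_imp_optical_channel, of E _ \<sigma> 1 0] assms
    by (intro bdd_aboveI2) auto
qed

theorem theorem5:
  fixes \<sigma> E :: real
  assumes "\<sigma> > 0" and "E > 0"
  shows "capacity \<sigma> E \<ge> 1/2 * ln (1 + E^2 * exp 1 / (2 * pi * \<sigma>^2)) \<and>
    (\<forall>\<beta> \<delta>. \<beta> > 0 \<longrightarrow> \<delta> \<le> - \<sigma> * exp (-1/2) \<longrightarrow>
      capacity \<sigma> E \<le>
        ln (\<beta> * exp (-(\<delta>^2) / (2 * \<sigma>^2)) + sqrt (2 * pi) * \<sigma> * Qfun (\<delta> / \<sigma>))
        - ln (sqrt (2 * pi) * \<sigma>) - \<delta> * E / (2 * \<sigma>^2)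
        + \<delta>^2 / (2 * \<sigma>^2) * (1 - Qfun (\<delta> / \<sigma>) - E / \<delta> * Qfun (\<delta> / \<sigma>))
        + 1 / \<beta> * (E + \<sigma> / sqrt (2 * pi))) \<and>
    (\<forall>\<beta> \<delta>. \<beta> > 0 \<longrightarrow> \<delta> \<ge> 0 \<longrightarrow>
      capacity \<sigma> E \<le>
        ln (\<beta> * exp (-(\<delta>^2) / (2 * \<sigma>^2)) + sqrt (2 * pi) * \<sigma> * Qfun (\<delta> / \<sigma>))
        + 1/2 * Qfun (\<delta> / \<sigma>) + \<delta> / (2 * sqrt (2 * pi) * \<sigma>) * exp (-(\<delta>^2) / (2 * \<sigma>^2))
        + \<delta>^2 / (2 * \<sigma>^2) * (1 - Qfun ((\<delta> + E) / \<sigma>))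
        + 1 / \<beta> * (\<delta> + E + \<sigma> / sqrt (2 * pi) * exp (-(\<delta>^2) / (2 * \<sigma>^2)))
        - 1/2 * ln (2 * pi * exp 1 * \<sigma>^2))"
proof (intro conjI allI impI)
  interpret exponential_input \<sigma> E using assms by unfold_locales
  show "1/2 * ln (1 + E^2 * exp 1 / (2 * pi * \<sigma>^2)) \<le> capacity \<sigma> E"
    using channel_MI_exponential_ge channel_MI_le_capacity[OF assms admissible_input_exponential[OF assms(2)]]
    by (rule order_trans)
next
  fix \<beta> \<delta> :: real
  assume "\<beta> > 0" and \<delta>: "\<delta> \<le> - \<sigma> * exp (-1/2)"
  moreover have "- \<sigma> * exp (-1/2) < 0" using assms by simp
  ultimately show "capacity \<sigma> E \<le>
        ln (\<beta> * exp (-(\<delta>^2) / (2 * \<sigma>^2)) + sqrt (2 * pi) * \<sigma> * Qfun (\<delta> / \<sigma>))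
        - ln (sqrt (2 * pi) * \<sigma>) - \<delta> * E / (2 * \<sigma>^2)
        + \<delta>^2 / (2 * \<sigma>^2) * (1 - Qfun (\<delta> / \<sigma>) - E / \<delta> * Qfun (\<delta> / \<sigma>))
        + 1 / \<beta> * (E + \<sigma> / sqrt (2 * pi))"
    using assms
    by (intro capacity_le optical_channel.channel_MI_le_neg admissible_input_imp_optical_channel) linarith+
next
  fix \<beta> \<delta> :: real
  assume "\<beta> > 0" "\<delta> \<ge> 0"
  then show "capacity \<sigma> E \<le>
        ln (\<beta> * exp (-(\<delta>^2) / (2 * \<sigma>^2)) + sqrt (2 * pi) * \<sigma> * Qfun (\<delta> / \<sigma>))
        + 1/2 * Qfun (\<delta> / \<sigma>) + \<delta> / (2 * sqrt (2 * pi) * \<sigma>) * exp (-(\<delta>^2) / (2 * \<sigma>^2))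
        + \<delta>^2 / (2 * \<sigma>^2) * (1 - Qfun ((\<delta> + E) / \<sigma>))
        + 1 / \<beta> * (\<delta> + E + \<sigma> / sqrt (2 * pi) * exp (-(\<delta>^2) / (2 * \<sigma>^2)))
        - 1/2 * ln (2 * pi * exp 1 * \<sigma>^2)"
    using assms
    by (intro capacity_le optical_channel.channel_MI_le_nonneg(1) admissible_input_imp_optical_channel) auto
qed

end
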